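(* Consider the class $\mathcal{P}_{HD}=\mathcal{P}_{HD}(R_X,R,B,s,\Phi_\Sigma)$ described in the context, with $\Phi_\Sigma<\frac{3R_X^2}{16}$. Suppose that for some $\rho\in(0,1)$ and $C_\rho>1$ there exists some $j\in[p]$ such that for all $i\in[p]\setminus\{j\}$, $$\sum_{k=1}^Kn_k\mathbb{1}_{\{i,j\in O_k\}}\le C_\rho\rho^2n_{\mathcal L}.$$ If $p-2\ge24(s-1)^2$, $s\ge2$ and $$C_\rho\rho^2n_{\mathcal L}+N\ge\frac{128s\log(p-2)}{9}\max\left\{1,\frac{1}{R_X^4}\right\}\min\left\{\frac{R^2}{B^2},1\right\},$$ then $$\inf_{\hat\beta\in\hat\Theta_{HD}}\sup_{P\in\mathcal{P}_{HD}}\mathbb{E}\left[\|\hat\beta-\beta^*\|_2^2\right]\ge\frac{1}{2^{17}C_\rho}\min\left\{1,\frac{2^6}{3^2R_X^4}\right\}\frac{\min\{R^2,B^2\}\,s\log\left(\frac{p-1}{2(s-1)}\right)}{\rho^2n_{\mathcal L}+N}.$$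
   Context: Data model: $(X,Y)\in\mathbb{R}^p\times\mathbb{R}$ with $X\sim P_X$, $\Sigma=\mathbb{E}[XX^T]$, and $Y=X^T\beta^*+\epsilon$, where $\beta^*\in\mathbb{R}^p$, $\mathbb{E}[\epsilon|X]=0$, $\mathrm{Var}[\epsilon|X]=\sigma^2$. There are $K$ fixed missingness patterns with observed sets $O_k\subseteq[p]$, $\cup_kO_k=[p]$. The labelled data consist, independently over $k\in[K]$, of $n_k$ i.i.d. copies of $(X_{O_k},Y)$, $n_{\mathcal L}=\sum_kn_k$; in addition there are $N\ge0$ unlabelled i.i.d. copies of $X$, independent of the labelled data. Class: for $R,B,R_X,\Phi_\Sigma>0$ and sparsity $s\in[0,p]$ (an integer), $\mathcal{P}_{HD}$ is the set of distributions of the full data on $\mathcal X=\prod_{k=1}^K(\mathbb{R}^{|O_k|+1})^{n_k}\times(\mathbb{R}^p)^N$ that arise when $Y=X^T\beta^*+\epsilon$ with $\mathbb{E}[\epsilon|X]=0$ and $\mathrm{Var}[\epsilon|X]=\sigma^2$, and the data consist, independently over $k\in[K]$, of $n_k$ i.i.d. copies of $(X_{O_k},Y)$ together with $N$ independent unlabelled i.i.d. copies of $X$, such that $\mathbb{E}[X]=0$, $\|X\|_{\psi_2}\le R_X$, $\epsilon$ is sub-Gaussian with parameter $\sigma$, $\Sigma$ satisfies $Re(s,\Phi_\Sigma)$, $\|\beta^*\|_0\le s$, $\|\beta^*\|_2\le B$ and $\sigma\le R$. $\hat\Theta_{HD}$ is the set of functions $\hat\beta:\mathcal X\to\mathbb{R}^p$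 such that $x\mapsto\|\hat\beta(x)-\beta^*(P)\|_2$ is (Borel) measurable for every $P\in\mathcal{P}_{HD}$; $\beta^*=\beta^*(P)$ is the regression parameter of the mechanism $P$ and the expectation is over data drawn from $P$. Definitions: $\|Z\|_{\psi_2}=\inf\{c>0:\mathbb{E}e^{Z^2/c^2}\le2\}$ for scalar $Z$ and $\|X\|_{\psi_2}=\sup_{\|u\|_2=1}\|u^TX\|_{\psi_2}$ for vectors. The (mean-zero) noise $\epsilon$ is sub-Gaussian with parameter $\sigma$ if $\mathbb{E}e^{t\epsilon}\le e^{t^2\sigma^2/2}$ for all $t\in\mathbb{R}$. $\|x\|_0$ is the number of nonzero entries of $x$. For $A\in\mathbb{R}^{p\times p}$, $$\phi^2(A,s)=\inf_{S\subset[p],|S|\le s}\ \inf_{\delta\ne0:\|\delta_{S^c}\|_1\le\|\delta_S\|_1}\frac{\delta^TA\delta}{\|\delta_{M(\delta)}\|_2^2},\quad M(\delta)=S\cup\{i\in S^c:|\delta_i|\ge|\delta_{S^c}|_{(\min\{s,|S^c|\})}\},$$ where $|\delta_{S^c}|_{(j)}$ is the $j$th largest absolute value among the entries of $\delta_{S^c}$. $A$ satisfies $Re(s,\Phi)$ if $\phi^2(A,s)\ge\Phi$. *)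

theory Defs
  imports "HOL-Probability.Probability"
begin

text \<open>
  The norm takes values in \<^typ>\<open>ennreal\<close> so that the infimum over the empty set is \<open>\<infinity>\<close>.
  All exponential moments are nonnegative Lebesgue integrals: a Bochner integral would be \<open>0\<close>
  (and the bounds would hold vacuously) when the exponential moment is infinite.
\<close>

definition psi2_norm :: "'a measure \<Rightarrow> ('a \<Rightarrow> real) \<Rightarrow> ennreal" where
  "psi2_norm M Z =
     (INF c\<in>{c::real. c > 0 \<and> (\<integral>\<^sup>+\<omega>. ennreal (exp ((Z \<omega>)\<^sup>2 / c\<^sup>2)) \<partial>M) \<le> 2}. ennreal c)"

definition psi2_norm_vec :: "'a measure \<Rightarrow> ('a \<Rightarrow> real^'p) \<Rightarrow> ennreal" where
  "psi2_norm_vec M X = (SUP u\<in>{u. norm u = 1}. psi2_norm M (\<lambda>\<omega>. u \<bullet> X \<omega>))"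

definition sub_gaussian :: "'a measure \<Rightarrow> ('a \<Rightarrow> real) \<Rightarrow> real \<Rightarrow> bool" where
  "sub_gaussian M Z \<sigma> \<longleftrightarrow>
     (\<forall>t::real. (\<integral>\<^sup>+\<omega>. ennreal (exp (t * Z \<omega>)) \<partial>M) \<le> ennreal (exp (t\<^sup>2 * \<sigma>\<^sup>2 / 2)))"

definition second_moment :: "'a measure \<Rightarrow> ('a \<Rightarrow> real^'p) \<Rightarrow> real^'p^'p" where
  "second_moment M X = (\<chi> i j. \<integral>\<omega>. X \<omega> $ i * X \<omega> $ j \<partial>M)"

definition real_cond_var :: "'a measure \<Rightarrow> 'a measure \<Rightarrow> ('a \<Rightarrow> real) \<Rightarrow> 'a \<Rightarrow> real" where
  "real_cond_var M F f = real_cond_exp M F (\<lambda>\<omega>. (f \<omega> - real_cond_exp M F f \<omega>)\<^sup>2)"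

definition l0 :: "real^'p \<Rightarrow> nat" where
  "l0 x = card {i. x $ i \<noteq> 0}"

text \<open>
  The \<open>j\<close>-th largest absolute value (counted with multiplicity, \<open>1 \<le> j \<le> card T\<close>) among the
  entries of \<open>\<delta>\<close> with index in \<open>T\<close>.
\<close>

definition kth_largest_abs :: "real^'p \<Rightarrow> 'p set \<Rightarrow> nat \<Rightarrow> real" where
  "kth_largest_abs \<delta> T j =
     rev (sorted_list_of_multiset (image_mset (\<lambda>i. \<bar>\<delta> $ i\<bar>) (mset_set T))) ! (j - 1)"

text \<open>
  For \<open>- S = {}\<close> the order statistic is a junk value, but then no index is tested against it.
\<close>

definition re_support :: "nat \<Rightarrow> 'p::finite set \<Rightarrow> real^'p \<Rightarrow> 'p set" where
  "re_support s S \<delta> =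
     S \<union> {i \<in> - S. \<bar>\<delta> $ i\<bar> \<ge> kth_largest_abs \<delta> (- S) (min s (card (- S)))}"

text \<open>
  The value is an extended real because there is no admissible \<open>\<delta>\<close> when \<open>S = {}\<close>; the
  denominator is positive for every admissible \<open>\<delta>\<close>.
\<close>

definition re_const :: "real^'p^'p \<Rightarrow> nat \<Rightarrow> ereal" where
  "re_const A s =
     (INF S\<in>{S :: 'p::finite set. card S \<le> s}.
      INF \<delta>\<in>{\<delta> :: real^'p. \<delta> \<noteq> 0 \<and> (\<Sum>i\<in>- S. \<bar>\<delta> $ i\<bar>) \<le> (\<Sum>i\<in>S. \<bar>\<delta> $ i\<bar>)}.
        ereal ((\<delta> \<bullet> (A *v \<delta>)) / (\<Sum>i\<in>re_support s S \<delta>. (\<delta> $ i)\<^sup>2)))"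

definition restricted_eigenvalue :: "real^'p^'p \<Rightarrow> nat \<Rightarrow> real \<Rightarrow> bool" where
  "restricted_eigenvalue A s \<Phi> \<longleftrightarrow> re_const A s \<ge> ereal \<Phi>"

text \<open>
  A mechanism consists of the joint law of \<open>(X, \<epsilon>)\<close>, the regression parameter \<open>\<beta>\<^sup>*\<close> and the noise
  level \<open>\<sigma>\<close>; the response is \<open>Y = X \<bullet> \<beta>\<^sup>* + \<epsilon>\<close>. The regression parameter is recorded explicitly
  because the law of the incomplete data need not determine it.
\<close>

record 'p mechanism =
  law :: "((real^'p) \<times> real) measure"
  beta :: "real^'p"
  sigma :: real

text \<open>
  Index ranges: patterns \<open>k < K\<close>, labelled observations \<open>i < n k\<close> of pattern \<open>k\<close>, unlabelled
  observations \<open>i < N\<close>. A partially observed covariate is a function on \<open>Obs k\<close>.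
\<close>

type_synonym 'p data = "(nat \<Rightarrow> nat \<Rightarrow> ('p \<Rightarrow> real) \<times> real) \<times> (nat \<Rightarrow> real^'p)"

definition data_space ::
  "nat \<Rightarrow> (nat \<Rightarrow> 'p::finite set) \<Rightarrow> (nat \<Rightarrow> nat) \<Rightarrow> nat \<Rightarrow> 'p data measure" where
  "data_space K Obs n N =
     (\<Pi>\<^sub>M k\<in>{..<K}. \<Pi>\<^sub>M i\<in>{..<n k}. (\<Pi>\<^sub>M l\<in>Obs k. borel) \<Otimes>\<^sub>M borel)
     \<Otimes>\<^sub>M (\<Pi>\<^sub>M i\<in>{..<N}. borel)"

definition labelled_law :: "'p::finite mechanism \<Rightarrow> 'p set \<Rightarrow> (('p \<Rightarrow> real) \<times> real) measure" where
  "labelled_law P S =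
     distr (law P) ((\<Pi>\<^sub>M l\<in>S. borel) \<Otimes>\<^sub>M borel)
       (\<lambda>(x, e). (\<lambda>l\<in>S. x $ l, x \<bullet> beta P + e))"

definition unlabelled_law :: "'p::finite mechanism \<Rightarrow> (real^'p) measure" where
  "unlabelled_law P = distr (law P) borel fst"

definition data_law ::
  "nat \<Rightarrow> (nat \<Rightarrow> 'p::finite set) \<Rightarrow> (nat \<Rightarrow> nat) \<Rightarrow> nat \<Rightarrow> 'p mechanism \<Rightarrow> 'p data measure" where
  "data_law K Obs n N P =
     (\<Pi>\<^sub>M k\<in>{..<K}. \<Pi>\<^sub>M i\<in>{..<n k}. labelled_law P (Obs k))
     \<Otimes>\<^sub>M (\<Pi>\<^sub>M i\<in>{..<N}. unlabelled_law P)"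

lemma sets_data_law: "sets (data_law K Obs n N P) = sets (data_space K Obs n N)"
  unfolding data_law_def data_space_def
  by (intro sets_pair_measure_cong sets_PiM_cong)
     (simp_all add: labelled_law_def unlabelled_law_def)

definition sigma_X :: "((real^'p::finite) \<times> real) measure \<Rightarrow> ((real^'p) \<times> real) measure" where
  "sigma_X M = vimage_algebra (space M) fst borel"

definition linear_model :: "'p::finite mechanism \<Rightarrow> bool" where
  "linear_model P \<longleftrightarrow>
     prob_space (law P) \<and> sets (law P) = sets borel \<and> 0 \<le> sigma P \<and>
     integrable (law P) snd \<and> integrable (law P) (\<lambda>z. (snd z)\<^sup>2) \<and>
     (AE z in law P. real_cond_exp (law P) (sigma_X (law P)) snd z = 0) \<and>
     (AE z in law P. real_cond_var (law P) (sigma_X (law P)) snd z = (sigma P)\<^sup>2)"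

definition P_HD :: "real \<Rightarrow> real \<Rightarrow> real \<Rightarrow> nat \<Rightarrow> real \<Rightarrow> 'p::finite mechanism set" where
  "P_HD R\<^sub>X R B s \<Phi> = {P. linear_model P \<and>
     integrable (law P) fst \<and> (\<integral>z. fst z \<partial>law P) = 0 \<and>
     psi2_norm_vec (law P) fst \<le> ennreal R\<^sub>X \<and>
     sub_gaussian (law P) snd (sigma P) \<and>
     restricted_eigenvalue (second_moment (law P) fst) s \<Phi> \<and>
     l0 (beta P) \<le> s \<and> norm (beta P) \<le> B \<and> sigma P \<le> R}"

definition Theta_HD ::
  "nat \<Rightarrow> (nat \<Rightarrow> 'p::finite set) \<Rightarrow> (nat \<Rightarrow> nat) \<Rightarrow> nat \<Rightarrow> real \<Rightarrow> real \<Rightarrow> real \<Rightarrow> nat \<Rightarrow> real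
   \<Rightarrow> ('p data \<Rightarrow> real^'p) set" where
  "Theta_HD K Obs n N R\<^sub>X R B s \<Phi> =
     {b. \<forall>P\<in>P_HD R\<^sub>X R B s \<Phi>.
           (\<lambda>x. norm (b x - beta P)) \<in> borel_measurable (data_space K Obs n N)}"

definition risk ::
  "nat \<Rightarrow> (nat \<Rightarrow> 'p::finite set) \<Rightarrow> (nat \<Rightarrow> nat) \<Rightarrow> nat \<Rightarrow> ('p data \<Rightarrow> real^'p) \<Rightarrow> 'p mechanism
   \<Rightarrow> ennreal" where
  "risk K Obs n N b P =
     (\<integral>\<^sup>+x. ennreal ((norm (b x - beta P))\<^sup>2) \<partial>data_law K Obs n N P)"

end

theory Submission
  imports Defs
begin

text \<open>
  The lower bound comes from not knowing how covariate \<open>j\<close> depends on the others. Let \<open>\<omega>\<close> have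
  independent coordinates, \<open>\<omega>\<^sub>j\<close> Gaussian and all others fair signs times \<open>r\<close>, and for a set \<open>S\<close> of
  \<open>s - 1\<close> indices put
    \<open>X = \<omega> + \<theta> (\<Sum>i\<in>S. \<omega>\<^sub>i) e\<^sub>j\<close>,  \<open>\<beta> = b (e\<^sub>j - \<theta> \<Sum>i\<in>S. e\<^sub>i)\<close>,
  with an independent Gaussian error \<open>\<epsilon>\<close>. Then \<open>X \<bullet> \<beta> = b \<omega>\<^sub>j\<close>, so the response carries no information
  about \<open>S\<close> by itself and is independent of the covariates other than \<open>j\<close>: the set \<open>S\<close>, hence \<open>\<beta>\<close>, is
  visible only through joint observations of \<open>X\<^sub>j\<close> and \<open>X\<^sub>i\<close> with \<open>i \<in> S\<close>. By hypothesis there are, with the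
  unlabelled ones, at most \<open>T = C \<rho>\<^sup>2 n\<^sub>L + N\<close> of these for each \<open>i\<close>.

  The covariance of \<open>X\<close> is a small perturbation of \<open>r\<^sup>2\<close> times the identity as long as
  \<open>\<theta>\<^sup>2 (s - 1) \<le> 1/16\<close>; with \<open>r = R\<^sub>X / 2\<close> its eigenvalues lie between \<open>3 R\<^sub>X\<^sup>2 / 16\<close> and \<open>3 R\<^sub>X\<^sup>2 / 8\<close>. The
  former gives the restricted eigenvalue condition and the latter the \<open>\<psi>\<^sub>2\<close> bound, because a variable
  with the moment generating function bound of variance \<open>v\<close> has \<open>\<psi>\<^sub>2\<close> norm at most \<open>sqrt (8 v / 3)\<close>
  (lemma \<open>mech_in_P_HD\<close>).

  The sets \<open>S\<close> are taken to contain exactly one index from each of \<open>m = s - 1\<close> disjoint blocks of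
  \<open>M = (p - 1) div m\<close> indices. Freeze the choice in all blocks but one. The \<open>M\<close> resulting data laws have a
  common reference law, in which the summand of that block is replaced by an independent sign.
  Adding \<open>\<theta> \<omega>\<^sub>i\<close> to \<open>\<omega>\<^sub>j\<close> while keeping the response fixed is a translation of the Gaussian pair
  \<open>(\<omega>\<^sub>j, \<epsilon>)\<close>, which has an exponential tilt as its density (lemma \<open>distr_shift\<close>). The second moment of the
  likelihood ratio against the reference is at most \<open>exp (\<theta>\<^sup>2 r\<^sup>2 (1 / r\<^sup>2 + b\<^sup>2 / R\<^sup>2))\<close> for one observation of \<open>X\<^sub>i\<close> together with \<open>X\<^sub>j\<close>
  and exactly \<open>1\<close> for all others (lemma \<open>chi2_bounded_labelled_law\<close>). These second moments multiply over
  independent observations. If the product is at most \<open>sqrt M\<close>, then by the Cauchy-Schwarz inequality no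
  test recognises the index of the block with average probability more than \<open>1/2\<close>
  (lemma \<open>sum_prob_data_law_le\<close>).

  A block whose index is not recognised contributes at least \<open>(b \<theta>)\<^sup>2 / 2\<close> to the squared error, so the
  average of the risk over all selections is at least \<open>(b \<theta>)\<^sup>2 m / 4\<close>
  (lemma \<open>exists_mech_with_large_risk\<close>). Finally \<open>b = 4 B / 5\<close> and \<open>\<theta>\<^sup>2\<close> is
  \<open>min 1 (R\<^sup>2 / B\<^sup>2) ln ((p - 1) / (2 m)) / T\<close> times a small factor that depends on \<open>R\<^sub>X\<close> only (lemma \<open>signal_size\<close>).
\<close>

section \<open>A functional form of the chi-square divergence\<close>

text \<open>
  For probability measures this says that the chi-square divergence of \<open>P\<close> from \<open>Q\<close> is at most \<open>c - 1\<close>.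
  Testing against all nonnegative functions instead of mentioning a density makes stability under image
  measures and under products immediate, and it also covers observations for which only the
  law before discarding the unobserved coordinates has an explicit density.
\<close>

definition chi2_bounded :: "ennreal \<Rightarrow> 'a measure \<Rightarrow> 'a measure \<Rightarrow> bool" where
  "chi2_bounded c P Q \<longleftrightarrow> sets P = sets Q \<and>
     (\<forall>f\<in>borel_measurable Q. (\<integral>\<^sup>+x. f x \<partial>P)\<^sup>2 \<le> c * (\<integral>\<^sup>+x. (f x)\<^sup>2 \<partial>Q))"

lemma chi2_boundedD:
  assumes "chi2_bounded c P Q" "f \<in> borel_measurable Q"
  shows "(\<integral>\<^sup>+x. f x \<partial>P)\<^sup>2 \<le> c * (\<integral>\<^sup>+x. (f x)\<^sup>2 \<partial>Q)"
  using assms unfolding chi2_bounded_def by blast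

lemma chi2_bounded_sets: "chi2_bounded c P Q \<Longrightarrow> sets P = sets Q"
  unfolding chi2_bounded_def by blast

lemma chi2_bounded_refl:
  assumes "prob_space P"
  shows "chi2_bounded 1 P P"
  unfolding chi2_bounded_def
proof safe
  fix f :: "'a \<Rightarrow> ennreal" assume [measurable]: "f \<in> borel_measurable P"
  interpret prob_space P by fact
  show "(\<integral>\<^sup>+x. f x \<partial>P)\<^sup>2 \<le> 1 * (\<integral>\<^sup>+x. (f x)\<^sup>2 \<partial>P)"
    using Cauchy_Schwarz_nn_integral[of f P "\<lambda>_. 1"] by (simp add: emeasure_space_1)
qed

lemma chi2_bounded_mono:
  assumes "chi2_bounded c P Q" "c \<le> d"
  shows "chi2_bounded d P Q"
  using assms unfolding chi2_bounded_def
  by (meson mult_right_mono order_trans zero_le)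

lemma chi2_bounded_distr:
  assumes P: "chi2_bounded c P Q" and G: "G \<in> measurable Q N"
  shows "chi2_bounded c (distr P N G) (distr Q N G)"
  unfolding chi2_bounded_def
proof safe
  fix f :: "_ \<Rightarrow> ennreal" assume f: "f \<in> borel_measurable (distr Q N G)"
  note [measurable] = G
  have GP: "G \<in> measurable P N"
    using G measurable_cong_sets[OF chi2_bounded_sets[OF P] refl] by blast
  have [measurable]: "f \<in> borel_measurable N" using f by simp
  have "(\<integral>\<^sup>+x. f x \<partial>distr P N G)\<^sup>2 = (\<integral>\<^sup>+x. f (G x) \<partial>P)\<^sup>2"
    using GP by (simp add: nn_integral_distr)
  also have "\<dots> \<le> c * (\<integral>\<^sup>+x. (f (G x))\<^sup>2 \<partial>Q)"
    by (rule chi2_boundedD[OF P]) measurable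
  also have "\<dots> = c * (\<integral>\<^sup>+x. (f x)\<^sup>2 \<partial>distr Q N G)"
    by (simp add: nn_integral_distr)
  finally show "(\<integral>\<^sup>+x. f x \<partial>distr P N G)\<^sup>2 \<le> c * (\<integral>\<^sup>+x. (f x)\<^sup>2 \<partial>distr Q N G)" .
qed simp_all

text \<open>
  Write the integrand of \<open>\<integral> f p\<close> as \<open>(p / sqrt q) (f sqrt q)\<close> and apply the Cauchy-Schwarz inequality.
\<close>

lemma chi2_bounded_density:
  fixes p q :: "'a \<Rightarrow> real"
  assumes [measurable]: "p \<in> borel_measurable M" "q \<in> borel_measurable M"
    and p: "\<And>x. p x \<ge> 0" and q: "\<And>x. q x > 0"
    and c: "(\<integral>\<^sup>+x. ennreal ((p x)\<^sup>2 / q x) \<partial>M) \<le> c"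
  shows "chi2_bounded c (density M (\<lambda>x. ennreal (p x))) (density M (\<lambda>x. ennreal (q x)))"
  unfolding chi2_bounded_def
proof safe
  fix f :: "_ \<Rightarrow> ennreal" assume "f \<in> borel_measurable (density M (\<lambda>x. ennreal (q x)))"
  then have [measurable]: "f \<in> borel_measurable M" by simp
  have "(\<integral>\<^sup>+x. f x \<partial>density M (\<lambda>x. ennreal (p x))) = (\<integral>\<^sup>+x. ennreal (p x) * f x \<partial>M)"
    by (simp add: nn_integral_density)
  also have "\<dots> = (\<integral>\<^sup>+x. ennreal (p x / sqrt (q x)) * (ennreal (sqrt (q x)) * f x) \<partial>M)"
  proof (intro nn_integral_cong)
    fix x
    have "sqrt (q x) > 0" using q[of x] by simp
    then have "ennreal (p x) = ennreal (p x / sqrt (q x)) * ennreal (sqrt (q x))"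
      using p[of x] by (subst ennreal_mult[symmetric]) auto
    then show "ennreal (p x) * f x = ennreal (p x / sqrt (q x)) * (ennreal (sqrt (q x)) * f x)"
      by (simp add: mult.assoc)
  qed
  finally have "(\<integral>\<^sup>+x. f x \<partial>density M (\<lambda>x. ennreal (p x)))\<^sup>2 \<le>
      (\<integral>\<^sup>+x. (ennreal (p x / sqrt (q x)))\<^sup>2 \<partial>M) * (\<integral>\<^sup>+x. (ennreal (sqrt (q x)) * f x)\<^sup>2 \<partial>M)"
    by (simp add: Cauchy_Schwarz_nn_integral)
  also have "(\<integral>\<^sup>+x. (ennreal (p x / sqrt (q x)))\<^sup>2 \<partial>M) = (\<integral>\<^sup>+x. ennreal ((p x)\<^sup>2 / q x) \<partial>M)"
    using p q by (intro nn_integral_cong)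
      (simp add: ennreal_power power_divide less_imp_le)
  also have "(\<integral>\<^sup>+x. (ennreal (sqrt (q x)) * f x)\<^sup>2 \<partial>M) = (\<integral>\<^sup>+x. ennreal (q x) * (f x)\<^sup>2 \<partial>M)"
    using q by (intro nn_integral_cong)
      (simp add: power_mult_distrib ennreal_power less_imp_le)
  also have "\<dots> = (\<integral>\<^sup>+x. (f x)\<^sup>2 \<partial>density M (\<lambda>x. ennreal (q x)))"
    by (simp add: nn_integral_density)
  also have "(\<integral>\<^sup>+x. ennreal ((p x)\<^sup>2 / q x) \<partial>M) * \<dots> \<le> c * \<dots>"
    by (rule mult_right_mono[OF c]) simp
  finally show "(\<integral>\<^sup>+x. f x \<partial>density M (\<lambda>x. ennreal (p x)))\<^sup>2 \<le>
     c * (\<integral>\<^sup>+x. (f x)\<^sup>2 \<partial>density M (\<lambda>x. ennreal (q x)))" .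
qed simp_all

text \<open>
  The bound for the first factor is applied to the inner integral as a function of the first variable,
  the bound for the second factor then pointwise under the outer integral.
\<close>

lemma chi2_bounded_pair:
  assumes P1: "chi2_bounded c1 P1 Q1" and P2: "chi2_bounded c2 P2 Q2"
    and "sigma_finite_measure P2" "sigma_finite_measure Q2"
  shows "chi2_bounded (c1 * c2) (P1 \<Otimes>\<^sub>M P2) (Q1 \<Otimes>\<^sub>M Q2)"
  unfolding chi2_bounded_def
proof (intro conjI ballI)
  note s1 = chi2_bounded_sets[OF P1] and s2 = chi2_bounded_sets[OF P2]
  show eq: "sets (P1 \<Otimes>\<^sub>M P2) = sets (Q1 \<Otimes>\<^sub>M Q2)"
    by (intro sets_pair_measure_cong s1 s2)
  fix f :: "_ \<Rightarrow> ennreal" assume f[measurable]: "f \<in> borel_measurable (Q1 \<Otimes>\<^sub>M Q2)"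
  then have fP: "f \<in> borel_measurable (P1 \<Otimes>\<^sub>M P2)"
    using measurable_cong_sets[OF eq refl] by blast
  interpret P2: sigma_finite_measure P2 by fact
  interpret Q2: sigma_finite_measure Q2 by fact
  have sp: "space P1 = space Q1" using s1 by (rule sets_eq_imp_space_eq)
  define g where "g x = (\<integral>\<^sup>+y. f (x, y) \<partial>P2)" for x
  have "g \<in> borel_measurable P1"
    unfolding g_def using P2.borel_measurable_nn_integral_fst[OF fP] .
  then have g: "g \<in> borel_measurable Q1"
    using measurable_cong_sets[OF s1 refl] by blast
  have "(\<integral>\<^sup>+z. f z \<partial>(P1 \<Otimes>\<^sub>M P2))\<^sup>2 = (\<integral>\<^sup>+x. g x \<partial>P1)\<^sup>2"
    by (simp add: g_def P2.nn_integral_fst[OF fP])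
  also have "\<dots> \<le> c1 * (\<integral>\<^sup>+x. (g x)\<^sup>2 \<partial>Q1)"
    by (rule chi2_boundedD[OF P1 g])
  also have "\<dots> \<le> c1 * (\<integral>\<^sup>+x. c2 * (\<integral>\<^sup>+y. (f (x, y))\<^sup>2 \<partial>Q2) \<partial>Q1)"
    unfolding g_def
    by (intro mult_left_mono nn_integral_mono chi2_boundedD[OF P2]) (auto intro: measurable_compose[OF measurable_Pair1'])
  also have "\<dots> = c1 * c2 * (\<integral>\<^sup>+z. (f z)\<^sup>2 \<partial>(Q1 \<Otimes>\<^sub>M Q2))"
    by (simp add: nn_integral_cmult mult.assoc Q2.nn_integral_fst[symmetric])
  finally show "(\<integral>\<^sup>+z. f z \<partial>(P1 \<Otimes>\<^sub>M P2))\<^sup>2 \<le> c1 * c2 * (\<integral>\<^sup>+z. (f z)\<^sup>2 \<partial>(Q1 \<Otimes>\<^sub>M Q2))" .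
qed

lemma chi2_bounded_PiM:
  fixes P Q :: "'i \<Rightarrow> 'a measure"
  assumes "finite I" and PQ: "\<And>i. chi2_bounded (c i) (P i) (Q i)"
    and P: "\<And>i. prob_space (P i)" and Q: "\<And>i. prob_space (Q i)"
  shows "chi2_bounded (\<Prod>i\<in>I. c i) (PiM I P) (PiM I Q)"
  using \<open>finite I\<close>
proof induction
  case empty
  have "prob_space (PiM {} P)" using P by (intro prob_space_PiM)
  moreover have "PiM {} P = PiM {} Q" by (simp add: PiM_empty)
  ultimately show ?case using chi2_bounded_refl[of "PiM {} P"] by simp
next
  case (insert i I)
  interpret P: product_prob_space P using P by (rule product_prob_spaceI)
  interpret Q: product_prob_space Q using Q by (rule product_prob_spaceI)
  have eq: "sets (PiM J P) = sets (PiM J Q)" for J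
    by (intro sets_PiM_cong chi2_bounded_sets[OF PQ] refl)
  show ?case unfolding chi2_bounded_def
  proof (intro conjI ballI)
    show "sets (PiM (insert i I) P) = sets (PiM (insert i I) Q)" by (rule eq)
    fix f :: "_ \<Rightarrow> ennreal" assume f[measurable]: "f \<in> borel_measurable (PiM (insert i I) Q)"
    then have fP[measurable]: "f \<in> borel_measurable (PiM (insert i I) P)"
      using measurable_cong_sets[OF eq refl] by blast
    define g where "g x = (\<integral>\<^sup>+y. f (x(i := y)) \<partial>P i)" for x
    have "g \<in> borel_measurable (PiM I P)"
      unfolding g_def by measurable
    then have g: "g \<in> borel_measurable (PiM I Q)"
      using measurable_cong_sets[OF eq refl] by blast
    have "(\<integral>\<^sup>+z. f z \<partial>PiM (insert i I) P)\<^sup>2 = (\<integral>\<^sup>+x. g x \<partial>PiM I P)\<^sup>2"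
      unfolding g_def using insert by (subst P.product_nn_integral_insert) auto
    also have "\<dots> \<le> (\<Prod>i\<in>I. c i) * (\<integral>\<^sup>+x. (g x)\<^sup>2 \<partial>PiM I Q)"
      by (rule chi2_boundedD[OF insert.IH g])
    also have "\<dots> \<le> (\<Prod>i\<in>I. c i) * (\<integral>\<^sup>+x. c i * (\<integral>\<^sup>+y. (f (x(i := y)))\<^sup>2 \<partial>Q i) \<partial>PiM I Q)"
      unfolding g_def using insert.hyps
      by (intro mult_left_mono nn_integral_mono chi2_boundedD[OF PQ])
        (auto intro: measurable_compose[OF measurable_component_update f])
    also have "\<dots> = (\<Prod>i\<in>insert i I. c i) * (\<integral>\<^sup>+z. (f z)\<^sup>2 \<partial>PiM (insert i I) Q)"
      using insert by (subst Q.product_nn_integral_insert) (auto simp: nn_integral_cmult mult_ac)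
    finally show "(\<integral>\<^sup>+z. f z \<partial>PiM (insert i I) P)\<^sup>2 \<le>
        (\<Prod>i\<in>insert i I. c i) * (\<integral>\<^sup>+z. (f z)\<^sup>2 \<partial>PiM (insert i I) Q)" .
  qed
qed

text \<open>
  Divided by the number of hypotheses, this bounds the average probability of guessing right among them.
  Each probability satisfies \<open>P\<^sub>i(A\<^sub>i)\<^sup>2 \<le> c Q(A\<^sub>i)\<close>, and the numbers \<open>Q(A\<^sub>i)\<close> sum to at most \<open>1\<close>.
\<close>

lemma sum_measure_disjoint_le_of_chi2_bounded:
  assumes "finite I" and Q: "prob_space Q"
    and chi: "\<And>i. i \<in> I \<Longrightarrow> chi2_bounded (ennreal c) (P i) Q" and "c \<ge> 0"
    and P: "\<And>i. i \<in> I \<Longrightarrow> prob_space (P i)"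
    and A: "\<And>i. i \<in> I \<Longrightarrow> A i \<in> sets Q" and disj: "disjoint_family_on A I"
  shows "(\<Sum>i\<in>I. measure (P i) (A i)) \<le> sqrt (real (card I) * c)"
proof -
  interpret Q: prob_space Q by fact
  have 1: "(measure (P i) (A i))\<^sup>2 \<le> c * measure Q (A i)" if i: "i \<in> I" for i
  proof -
    interpret prob_space "P i" using P[OF i] .
    have [simp]: "A i \<in> sets (P i)" "A i \<in> sets Q"
      using A[OF i] chi2_bounded_sets[OF chi[OF i]] by auto
    have [simp]: "(\<lambda>x. (indicator (A i) x :: ennreal)\<^sup>2) = indicator (A i)"
      by (auto simp: fun_eq_iff indicator_def)
    have "(emeasure (P i) (A i))\<^sup>2 \<le> ennreal c * emeasure Q (A i)"
      using chi2_boundedD[OF chi[OF i], of "indicator (A i)"] A[OF i] by simp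
    then show ?thesis using \<open>c \<ge> 0\<close>
      by (simp add: emeasure_eq_measure Q.emeasure_eq_measure ennreal_power ennreal_mult[symmetric])
  qed
  have "(\<Sum>i\<in>I. measure (P i) (A i))\<^sup>2 \<le> real (card I) * (\<Sum>i\<in>I. (measure (P i) (A i))\<^sup>2)"
    using sum_squared_le_sum_of_squares[of "\<lambda>i. measure (P i) (A i)" I] \<open>finite I\<close>
    by (cases "I = {}") (simp_all add: mult.commute)
  also have "\<dots> \<le> real (card I) * (\<Sum>i\<in>I. c * measure Q (A i))"
    by (intro mult_left_mono sum_mono 1) auto
  also have "\<dots> = real (card I) * c * (\<Sum>i\<in>I. measure Q (A i))"
    by (simp add: sum_distrib_left mult_ac)
  also have "(\<Sum>i\<in>I. measure Q (A i)) = measure Q (\<Union>i\<in>I. A i)"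
    using A disj \<open>finite I\<close> by (intro Q.finite_measure_finite_Union[symmetric]) auto
  also have "real (card I) * c * \<dots> \<le> real (card I) * c * 1"
    using \<open>c \<ge> 0\<close> by (intro mult_left_mono) auto
  finally show ?thesis by (simp add: real_le_rsqrt)
qed

section \<open>Symmetric signs and centred Gaussians\<close>

definition sign_law :: "real \<Rightarrow> real measure" where
  "sign_law r = distr (measure_pmf (bernoulli_pmf (1/2))) borel (\<lambda>b. if b then r else - r)"

definition gauss_law :: "real \<Rightarrow> real measure" where
  "gauss_law s = density lborel (\<lambda>x. ennreal (normal_density 0 s x))"

lemma sets_sign_law[simp, measurable_cong]: "sets (sign_law r) = sets borel"
  and space_sign_law[simp]: "space (sign_law r) = UNIV"
  by (simp_all add: sign_law_def)

lemma sets_gauss_law[simp, measurable_cong]: "sets (gauss_law s) = sets borel"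
  and space_gauss_law[simp]: "space (gauss_law s) = UNIV"
  by (simp_all add: gauss_law_def)

lemma prob_space_sign_law: "prob_space (sign_law r)"
  unfolding sign_law_def by (intro prob_space.prob_space_distr prob_space_measure_pmf) simp

lemma prob_space_gauss_law: "s > 0 \<Longrightarrow> prob_space (gauss_law s)"
  unfolding gauss_law_def by (rule prob_space_normal_density)

lemma nn_integral_sign_law:
  assumes [measurable]: "f \<in> borel_measurable borel"
  shows "(\<integral>\<^sup>+x. f x \<partial>sign_law r) = ennreal (1/2) * (f r + f (- r))"
  by (simp add: sign_law_def nn_integral_distr distrib_left mult.commute)

lemma
  fixes f :: "real \<Rightarrow> real"
  assumes [measurable]: "f \<in> borel_measurable borel"
  shows integrable_sign_law: "integrable (sign_law r) f"
    and integral_sign_law: "(\<integral>x. f x \<partial>sign_law r) = (f r + f (- r)) / 2"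
proof -
  show "integrable (sign_law r) f"
    unfolding sign_law_def
    by (subst integrable_distr_eq) (auto intro: integrable_measure_pmf_finite)
  show "(\<integral>x. f x \<partial>sign_law r) = (f r + f (- r)) / 2"
    unfolding sign_law_def by (subst integral_distr) auto
qed

lemma nn_integral_gauss_law:
  assumes [measurable]: "f \<in> borel_measurable borel"
  shows "(\<integral>\<^sup>+x. f x \<partial>gauss_law s) = (\<integral>\<^sup>+x. ennreal (normal_density 0 s x) * f x \<partial>lborel)"
  unfolding gauss_law_def by (subst nn_integral_density) auto

text \<open>
  The Cameron-Martin formula on the line: a translated Gaussian is an exponential tilt of the original.
\<close>

lemma nn_integral_gauss_law_shift:
  assumes "s > 0" and [measurable]: "f \<in> borel_measurable borel"
  shows "(\<integral>\<^sup>+x. f (x + t) \<partial>gauss_law s) =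
    (\<integral>\<^sup>+x. f x * ennreal (exp (t * x / s\<^sup>2 - t\<^sup>2 / (2 * s\<^sup>2))) \<partial>gauss_law s)"
proof -
  have eq: "normal_density 0 s (x - t) =
      normal_density 0 s x * exp (t * x / s\<^sup>2 - t\<^sup>2 / (2 * s\<^sup>2))" for x
  proof -
    have "- (x - t)\<^sup>2 / (2 * s\<^sup>2) = - x\<^sup>2 / (2 * s\<^sup>2) + (t * x / s\<^sup>2 - t\<^sup>2 / (2 * s\<^sup>2))"
      using assms by (simp add: field_simps power2_eq_square)
    then show ?thesis unfolding normal_density_def by (simp only: exp_add diff_0_right mult.assoc)
  qed
  have "(\<integral>\<^sup>+x. f (x + t) \<partial>gauss_law s) = (\<integral>\<^sup>+x. ennreal (normal_density 0 s x) * f (x + t) \<partial>lborel)"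
    by (rule nn_integral_gauss_law) measurable
  also have "\<dots> = (\<integral>\<^sup>+x. ennreal (normal_density 0 s (x - t)) * f x \<partial>lborel)"
    by (subst nn_integral_real_affine[where c = 1 and t = t]) (simp_all add: add.commute)
  also have "\<dots> = (\<integral>\<^sup>+x. ennreal (normal_density 0 s x) *
      (f x * ennreal (exp (t * x / s\<^sup>2 - t\<^sup>2 / (2 * s\<^sup>2)))) \<partial>lborel)"
    by (simp add: eq ennreal_mult mult_ac)
  also have "\<dots> = (\<integral>\<^sup>+x. f x * ennreal (exp (t * x / s\<^sup>2 - t\<^sup>2 / (2 * s\<^sup>2))) \<partial>gauss_law s)"
    by (rule nn_integral_gauss_law[symmetric]) measurable
  finally show ?thesis .
qed

lemma nn_integral_exp_gauss_law:
  assumes "s > 0"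
  shows "(\<integral>\<^sup>+x. ennreal (exp (t * x)) \<partial>gauss_law s) = ennreal (exp (t\<^sup>2 * s\<^sup>2 / 2))"
proof -
  interpret prob_space "gauss_law s" using assms by (rule prob_space_gauss_law)
  have eq: "exp (t * x) = exp (t * s\<^sup>2 * x / s\<^sup>2 - (t * s\<^sup>2)\<^sup>2 / (2 * s\<^sup>2)) * exp (t\<^sup>2 * s\<^sup>2 / 2)" for x
    using assms by (simp add: exp_add[symmetric] field_simps power2_eq_square)
  have 1: "(\<integral>\<^sup>+x. 1 * ennreal (exp (t * s\<^sup>2 * x / s\<^sup>2 - (t * s\<^sup>2)\<^sup>2 / (2 * s\<^sup>2))) \<partial>gauss_law s) = 1"
    by (subst nn_integral_gauss_law_shift[OF assms, symmetric]) (simp_all add: emeasure_space_1[simplified])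
  show ?thesis
    using 1 by (subst eq) (simp add: ennreal_mult nn_integral_multc del: exp_le_cancel_iff)
qed

lemma
  assumes "s > 0"
  shows integrable_gauss_law: "integrable (gauss_law s) (\<lambda>x. x)"
    and integral_gauss_law: "(\<integral>x. x \<partial>gauss_law s) = 0"
    and integrable_gauss_law_square: "integrable (gauss_law s) (\<lambda>x. x\<^sup>2)"
    and integral_gauss_law_square: "(\<integral>x. x\<^sup>2 \<partial>gauss_law s) = s\<^sup>2"
proof -
  show "integrable (gauss_law s) (\<lambda>x. x)" "(\<integral>x. x \<partial>gauss_law s) = 0"
    unfolding gauss_law_def using integrable_normal_moment_nz_1[OF assms, of 0] integral_normal_moment_nz_1[OF assms, of 0]
    by (simp_all add: integrable_density integral_density)
  show "integrable (gauss_law s) (\<lambda>x. x\<^sup>2)" "(\<integral>x. x\<^sup>2 \<partial>gauss_law s) = s\<^sup>2"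
    unfolding gauss_law_def using integrable_normal_moment[OF assms, of 0 2] integral_normal_moment_even[OF assms, of 0 1]
    by (simp_all add: integrable_density integral_density fact_numeral)
qed

text \<open>
  The constant \<open>3/8\<close> is the one for which the weight \<open>exp (a x\<^sup>2)\<close> turns the standard normal density into
  exactly twice the normal density with standard deviation \<open>2\<close>.
\<close>

lemma nn_integral_exp_square_gauss_law:
  assumes "a \<le> 3/8"
  shows "(\<integral>\<^sup>+x. ennreal (exp (a * x\<^sup>2)) \<partial>gauss_law 1) \<le> 2"
proof -
  interpret prob_space "gauss_law 2" by (rule prob_space_gauss_law) simp
  have "(\<integral>\<^sup>+x. ennreal (exp (a * x\<^sup>2)) \<partial>gauss_law 1) \<le> (\<integral>\<^sup>+x. ennreal (exp (3/8 * x\<^sup>2)) \<partial>gauss_law 1)"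
    using assms by (intro nn_integral_mono ennreal_leI) (auto intro!: mult_right_mono simp del: times_divide_eq_left)
  also have "\<dots> = (\<integral>\<^sup>+x. ennreal (normal_density 0 1 x) * ennreal (exp (3/8 * x\<^sup>2)) \<partial>lborel)"
    by (rule nn_integral_gauss_law) measurable
  also have "\<dots> = (\<integral>\<^sup>+x. ennreal (normal_density 0 2 x) * 2 \<partial>lborel)"
  proof (intro nn_integral_cong)
    fix x :: real
    have 1: "exp (- x\<^sup>2 / 2) * exp (3/8 * x\<^sup>2) = exp (- x\<^sup>2 / 8)"
      by (simp add: exp_add[symmetric])
    have 2: "sqrt (8 * pi) = 2 * sqrt (2 * pi)"
      using real_sqrt_mult[of 4 "2 * pi"] by simp
    have "normal_density 0 1 x * exp (3/8 * x\<^sup>2) = normal_density 0 2 x * 2"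
      unfolding normal_density_def using 1 2 by (simp add: field_simps)
    then show "ennreal (normal_density 0 1 x) * ennreal (exp (3/8 * x\<^sup>2)) = ennreal (normal_density 0 2 x) * 2"
      by (metis ennreal_mult'' exp_ge_zero ennreal_numeral zero_le_numeral)
  qed
  also have "\<dots> = (\<integral>\<^sup>+x. 2 \<partial>gauss_law 2)"
    by (rule nn_integral_gauss_law[symmetric]) measurable
  also have "\<dots> = 2" by (simp add: emeasure_space_1[simplified])
  finally show ?thesis .
qed

text \<open>
  Gaussian linearisation: \<open>exp (w\<^sup>2 / c\<^sup>2)\<close> is the expectation of \<open>exp (sqrt 2 g w / c)\<close> over a standard
  normal \<open>g\<close>. After exchanging the two expectations, only the moment generating function of \<open>W\<close> enters.
\<close>

lemma psi2_norm_le_of_mgf: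
  assumes M: "prob_space M" and [measurable]: "W \<in> borel_measurable M" and "c > 0"
    and mgf: "\<And>t. (\<integral>\<^sup>+\<omega>. ennreal (exp (t * W \<omega>)) \<partial>M) \<le> ennreal (exp (t\<^sup>2 * v / 2))"
    and v: "v \<le> 3 * c\<^sup>2 / 8"
  shows "psi2_norm M W \<le> ennreal c"
proof -
  interpret prob_space M by fact
  interpret G: prob_space "gauss_law 1" by (rule prob_space_gauss_law) simp
  interpret pair_sigma_finite M "gauss_law 1" ..
  have "(\<integral>\<^sup>+\<omega>. ennreal (exp ((W \<omega>)\<^sup>2 / c\<^sup>2)) \<partial>M) =
      (\<integral>\<^sup>+\<omega>. (\<integral>\<^sup>+g. ennreal (exp (sqrt 2 / c * W \<omega> * g)) \<partial>gauss_law 1) \<partial>M)"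
    by (subst nn_integral_exp_gauss_law)
       (auto simp: power_mult_distrib power_divide intro!: nn_integral_cong)
  also have "\<dots> = (\<integral>\<^sup>+g. (\<integral>\<^sup>+\<omega>. ennreal (exp (sqrt 2 / c * g * W \<omega>)) \<partial>M) \<partial>gauss_law 1)"
    by (subst Fubini'[symmetric]) (auto simp: mult_ac)
  also have "\<dots> \<le> (\<integral>\<^sup>+g. ennreal (exp ((sqrt 2 / c * g)\<^sup>2 * v / 2)) \<partial>gauss_law 1)"
    by (intro nn_integral_mono mgf)
  also have "\<dots> = (\<integral>\<^sup>+g. ennreal (exp (v / c\<^sup>2 * g\<^sup>2)) \<partial>gauss_law 1)"
    by (simp add: power_mult_distrib power_divide mult_ac)
  also have "\<dots> \<le> 2"
    using v \<open>c > 0\<close> by (intro nn_integral_exp_square_gauss_law) (simp add: field_simps)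
  finally show ?thesis
    unfolding psi2_norm_def using \<open>c > 0\<close> by (intro INF_lower) auto
qed

text \<open>
  The inequality \<open>cosh x \<le> exp (x\<^sup>2 / 2)\<close> is the symmetric case of the analytic core of Hoeffding's lemma.
\<close>

lemma nn_integral_exp_sign_law_le:
  "(\<integral>\<^sup>+x. ennreal (exp (t * x)) \<partial>sign_law r) \<le> ennreal (exp (t\<^sup>2 * r\<^sup>2 / 2))"
proof -
  have cosh: "(exp x + exp (- x)) / 2 \<le> exp (x\<^sup>2 / 2)" if "x \<ge> 0" for x :: real
  proof -
    have "exp (2 * x) \<ge> 1" using that by simp
    then have pos: "1 + (1/2) * (exp (2 * x) - 1) > 0"
      by (intro add_pos_nonneg mult_nonneg_nonneg) simp_all
    have "(exp x + exp (- x)) / 2 = exp (- x) * (1 + (1/2) * (exp (2 * x) - 1))"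
      by (simp add: field_simps exp_add[symmetric])
    also have "\<dots> = exp (- x + ln (1 + (1/2) * (exp (2 * x) - 1)))"
      using pos by (simp only: exp_add exp_ln)
    also have "\<dots> \<le> exp (x\<^sup>2 / 2)"
      using Hoeffdings_lemma_aux[of "2 * x" "1/2"] that by (simp add: power_mult_distrib)
    finally show ?thesis .
  qed
  have "(exp (t * r) + exp (- (t * r))) / 2 \<le> exp (t\<^sup>2 * r\<^sup>2 / 2)"
    using cosh[of "\<bar>t * r\<bar>"] by (cases "t * r \<ge> 0") (simp_all add: power_mult_distrib add.commute)
  then have "ennreal ((exp (t * r) + exp (- (t * r))) / 2) \<le> ennreal (exp (t\<^sup>2 * r\<^sup>2 / 2))"
    by (rule ennreal_leI)
  moreover have "ennreal (1/2) * (ennreal (exp (t * r)) + ennreal (exp (t * - r))) =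
      ennreal ((exp (t * r) + exp (- (t * r))) / 2)"
    by (subst ennreal_plus[symmetric]) (simp_all only: ennreal_mult[symmetric] exp_ge_zero add_nonneg_nonneg, simp_all)
  ultimately show ?thesis
    by (subst nn_integral_sign_law) simp_all
qed

section \<open>The spiked design\<close>

lemma borel_measurable_vec_nth [measurable]:
  "(\<lambda>x :: real^'n. x $ l) \<in> borel_measurable borel"
proof -
  have "(\<lambda>x :: real^'n. x $ l) = (\<lambda>x. x \<bullet> axis l 1)" by (simp add: inner_axis)
  then show ?thesis by simp
qed

lemma borel_measurable_vec_lambda [measurable (raw)]:
  assumes "\<And>l :: 'n::finite. (\<lambda>x. f x l) \<in> borel_measurable M"
  shows "(\<lambda>x. (\<chi> l. f x l) :: real^'n) \<in> borel_measurable M"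
  unfolding borel_measurable_euclidean_space[where f = "\<lambda>x. (\<chi> l. f x l) :: real^'n"]
  using assms by (auto simp: Basis_vec_def inner_axis)

lemma distr_pair_snd:
  assumes "prob_space M" "prob_space N"
  shows "distr (M \<Otimes>\<^sub>M N) N snd = N"
proof (rule measure_eqI)
  interpret M: prob_space M by fact
  interpret N: prob_space N by fact
  fix A assume "A \<in> sets (distr (M \<Otimes>\<^sub>M N) N snd)"
  then have A: "A \<in> sets N" by simp
  then have "snd -` A \<inter> space (M \<Otimes>\<^sub>M N) = space M \<times> A"
    using sets.sets_into_space by (auto simp: space_pair_measure)
  then show "emeasure (distr (M \<Otimes>\<^sub>M N) N snd) A = emeasure N A"
    using A by (simp add: emeasure_distr N.emeasure_pair_measure_Times M.emeasure_space_1)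
qed simp

text \<open>
  The mechanisms used as hypotheses. The independent vector \<open>\<omega>\<close> has law \<open>latent\<close>; covariate \<open>j\<close> picks up \<open>\<theta>\<close>
  times the latent coordinates in \<open>S\<close>, and the regression parameter undoes exactly this, so that
  the regression function is \<open>b \<omega>\<^sub>j\<close>. All latent coordinates have the same variance \<open>r\<^sup>2\<close>. Signs are used for
  the coordinates other than \<open>j\<close> because a randomised sign admits an explicit likelihood ratio;
  coordinate \<open>j\<close> and the error are Gaussian because they have to absorb translations.
\<close>

locale spiked_design =
  fixes j :: "'p::finite" and r \<theta> b R :: real
  assumes r: "r > 0" and R: "R > 0"
begin

definition coord :: "'p \<Rightarrow> real measure" where
  "coord l = (if l = j then gauss_law r else sign_law r)"

definition latent :: "('p \<Rightarrow> real) measure" where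
  "latent = PiM UNIV coord"

definition design :: "'p set \<Rightarrow> ('p \<Rightarrow> real) \<Rightarrow> real^'p" where
  "design S \<omega> = (\<chi> l. \<omega> l + (if l = j then \<theta> * (\<Sum>i\<in>S. \<omega> i) else 0))"

definition mech :: "'p set \<Rightarrow> 'p mechanism" where
  "mech S = \<lparr>law = distr latent borel (design S) \<Otimes>\<^sub>M gauss_law R,
     beta = (\<chi> l. if l = j then b else if l \<in> S then - b * \<theta> else 0), sigma = R\<rparr>"

lemma mech_simps [simp]:
  "law (mech S) = distr latent borel (design S) \<Otimes>\<^sub>M gauss_law R"
  "beta (mech S) = (\<chi> l. if l = j then b else if l \<in> S then - b * \<theta> else 0)"
  "sigma (mech S) = R"
  by (simp_all add: mech_def)

lemma sets_coord [simp, measurable_cong]: "sets (coord l) = sets borel"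
  and space_coord [simp]: "space (coord l) = UNIV"
  and prob_space_coord: "prob_space (coord l)"
  using r by (auto simp: coord_def prob_space_gauss_law prob_space_sign_law)

lemma prob_space_latent: "prob_space latent"
  unfolding latent_def by (rule prob_space_PiM) (rule prob_space_coord)

lemma sets_latent [measurable_cong]: "sets latent = sets (PiM UNIV (\<lambda>_. borel))"
  unfolding latent_def by (intro sets_PiM_cong) auto

lemma space_latent [simp]: "space latent = UNIV"
  unfolding latent_def by (simp add: space_PiM)

lemma measurable_latent_component: "(\<lambda>\<omega>. \<omega> l) \<in> borel_measurable latent"
  by (subst measurable_cong_sets[OF sets_latent refl]) measurable

lemma measurable_design [measurable]: "design S \<in> borel_measurable latent"
proof -
  note [measurable] = measurable_latent_component
  show ?thesis unfolding design_def by measurable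
qed

lemma prob_space_gauss: "prob_space (gauss_law R)"
  using R by (rule prob_space_gauss_law)

lemma prob_space_design: "prob_space (distr latent borel (design S))"
  by (intro prob_space.prob_space_distr prob_space_latent) measurable

lemma prob_space_law: "prob_space (law (mech S))"
  using prob_space_pair[OF prob_space_design prob_space_gauss] by simp

lemma product_prob_space_coord: "product_prob_space coord"
  by (rule product_prob_spaceI) (rule prob_space_coord)

lemma
  shows integrable_coord: "integrable (coord l) (\<lambda>x. x)" "integrable (coord l) (\<lambda>x. x * x)"
    and integral_coord: "(\<integral>x. x \<partial>coord l) = 0" "(\<integral>x. x * x \<partial>coord l) = r\<^sup>2"
proof -
  have "integrable (gauss_law r) (\<lambda>x. x * x)" "(\<integral>x. x * x \<partial>gauss_law r) = r\<^sup>2"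
    using integrable_gauss_law_square[OF r] integral_gauss_law_square[OF r]
    by (simp_all only: power2_eq_square)
  moreover have "integrable (sign_law r) (\<lambda>x. x * x)" "integrable (sign_law r) (\<lambda>x. x)"
    by (rule integrable_sign_law, measurable)+
  moreover have "(\<integral>x. x * x \<partial>sign_law r) = r\<^sup>2" "(\<integral>x. x \<partial>sign_law r) = 0"
    by (subst integral_sign_law; simp add: power2_eq_square)+
  ultimately show "integrable (coord l) (\<lambda>x. x)" "integrable (coord l) (\<lambda>x. x * x)"
    "(\<integral>x. x \<partial>coord l) = 0" "(\<integral>x. x * x \<partial>coord l) = r\<^sup>2"
    using integrable_gauss_law[OF r] integral_gauss_law[OF r] unfolding coord_def
    by (cases "l = j"; simp only: if_True if_False simp_thms)+
qed

lemma
  shows integrable_latent: "integrable latent (\<lambda>\<omega>. \<omega> l)"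
    and integral_latent: "(\<integral>\<omega>. \<omega> l \<partial>latent) = 0"
proof -
  interpret coord: product_prob_space coord by (rule product_prob_space_coord)
  have eq: "(\<lambda>\<omega>. \<omega> l) = (\<lambda>\<omega>. \<Prod>i\<in>UNIV. (if i = l then \<omega> i else 1))" by (simp add: fun_eq_iff)
  have int: "integrable (coord i) (\<lambda>x. if i = l then x else 1)" for i
    using integrable_coord[of i] by (cases "i = l") simp_all
  show "integrable latent (\<lambda>\<omega>. \<omega> l)"
    unfolding latent_def eq
    by (rule coord.product_integrable_prod[where f = "\<lambda>i x. if i = l then x else 1"]) (auto intro: int)
  have "(\<integral>\<omega>. \<omega> l \<partial>latent) = (\<Prod>i\<in>UNIV. \<integral>x. (if i = l then x else 1) \<partial>coord i)"
    unfolding latent_def eq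
    by (rule coord.product_integral_prod[where f = "\<lambda>i x. if i = l then x else 1"]) (auto intro: int)
  also have "\<dots> = 0"
    by (rule prod_zero, simp, rule bexI[of _ l]) (simp_all add: integral_coord)
  finally show "(\<integral>\<omega>. \<omega> l \<partial>latent) = 0" .
qed

lemma
  shows integrable_latent_mult: "integrable latent (\<lambda>\<omega>. \<omega> l * \<omega> k)"
    and integral_latent_mult: "(\<integral>\<omega>. \<omega> l * \<omega> k \<partial>latent) = (if l = k then r\<^sup>2 else 0)"
proof -
  interpret coord: product_prob_space coord by (rule product_prob_space_coord)
  define f where "f = (\<lambda>i (x::real). (if i = l then x else 1) * (if i = k then x else 1))"
  have eq: "(\<lambda>\<omega>. \<omega> l * \<omega> k) = (\<lambda>\<omega>. \<Prod>i\<in>UNIV. f i (\<omega> i))"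
    by (simp add: fun_eq_iff f_def prod.distrib)
  have int: "integrable (coord i) (f i)" for i
    using integrable_coord[of i]
    by (cases "i = l"; cases "i = k") (simp_all add: f_def)
  show "integrable latent (\<lambda>\<omega>. \<omega> l * \<omega> k)"
    unfolding latent_def eq by (rule coord.product_integrable_prod) (auto intro: int)
  have I: "(\<integral>\<omega>. \<omega> l * \<omega> k \<partial>latent) = (\<Prod>i\<in>UNIV. \<integral>x. f i x \<partial>coord i)"
    unfolding latent_def eq by (rule coord.product_integral_prod) (auto intro: int)
  show "(\<integral>\<omega>. \<omega> l * \<omega> k \<partial>latent) = (if l = k then r\<^sup>2 else 0)"
  proof (cases "l = k")
    case True
    have "(\<integral>x. f i x \<partial>coord i) = (if i = k then r\<^sup>2 else 1)" for i
      using True integral_coord prob_space.prob_space[OF prob_space_coord, of i] by (simp add: f_def)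
    then show ?thesis unfolding I using True by simp
  next
    case False
    have "(\<integral>x. f l x \<partial>coord l) = 0" using False integral_coord by (simp add: f_def)
    then show ?thesis unfolding I using False by (auto intro!: prod_zero)
  qed
qed

text \<open>
  The latent coordinates are orthogonal in \<open>L\<^sup>2\<close> with common squared norm \<open>r\<^sup>2\<close>.
\<close>

lemma
  shows integrable_linear_mult: "integrable latent (\<lambda>\<omega>. (\<Sum>l\<in>UNIV. v l * \<omega> l) * (\<Sum>l\<in>UNIV. w l * \<omega> l))"
    and integral_linear_square: "(\<integral>\<omega>. (\<Sum>l\<in>UNIV. v l * \<omega> l)\<^sup>2 \<partial>latent) = r\<^sup>2 * (\<Sum>l\<in>UNIV. (v l)\<^sup>2)"
proof -
  have eq: "(\<Sum>l\<in>UNIV. v l * \<omega> l) * (\<Sum>l\<in>UNIV. w l * \<omega> l) =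
      (\<Sum>l\<in>UNIV. \<Sum>k\<in>UNIV. v l * w k * (\<omega> l * \<omega> k))" for v w \<omega> :: "'p \<Rightarrow> real"
    by (simp add: sum_product mult_ac)
  show "integrable latent (\<lambda>\<omega>. (\<Sum>l\<in>UNIV. v l * \<omega> l) * (\<Sum>l\<in>UNIV. w l * \<omega> l))"
    unfolding eq by (intro Bochner_Integration.integrable_sum integrable_mult_right integrable_latent_mult)
  have "(\<integral>\<omega>. (\<Sum>l\<in>UNIV. v l * \<omega> l)\<^sup>2 \<partial>latent) = (\<Sum>l\<in>UNIV. \<Sum>k\<in>UNIV. v l * v k * (if l = k then r\<^sup>2 else 0))"
    unfolding power2_eq_square[of "\<Sum>l\<in>UNIV. v l * _ l"] eq
    by (simp add: integral_latent_mult integrable_latent_mult Bochner_Integration.integral_sum)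
  also have "\<dots> = r\<^sup>2 * (\<Sum>l\<in>UNIV. (v l)\<^sup>2)"
    by (simp add: sum_distrib_left power2_eq_square mult_ac if_distrib cong: if_cong)
  finally show "(\<integral>\<omega>. (\<Sum>l\<in>UNIV. v l * \<omega> l)\<^sup>2 \<partial>latent) = r\<^sup>2 * (\<Sum>l\<in>UNIV. (v l)\<^sup>2)" .
qed

lemma nn_integral_exp_linear_le:
  "(\<integral>\<^sup>+\<omega>. ennreal (exp (t * (\<Sum>l\<in>UNIV. w l * \<omega> l))) \<partial>latent)
    \<le> ennreal (exp (t\<^sup>2 * (r\<^sup>2 * (\<Sum>l\<in>UNIV. (w l)\<^sup>2)) / 2))"
proof -
  interpret coord: product_prob_space coord by (rule product_prob_space_coord)
  have "(\<integral>\<^sup>+\<omega>. ennreal (exp (t * (\<Sum>l\<in>UNIV. w l * \<omega> l))) \<partial>latent) =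
      (\<integral>\<^sup>+\<omega>. (\<Prod>l\<in>UNIV. ennreal (exp (t * w l * \<omega> l))) \<partial>latent)"
    by (simp add: sum_distrib_left exp_sum prod_ennreal mult.assoc)
  also have "\<dots> = (\<Prod>l\<in>UNIV. \<integral>\<^sup>+x. ennreal (exp (t * w l * x)) \<partial>coord l)"
    unfolding latent_def
    by (rule coord.product_nn_integral_prod, simp, subst measurable_cong_sets[OF sets_coord refl], simp)
  also have "\<dots> \<le> (\<Prod>l\<in>UNIV. ennreal (exp ((t * w l)\<^sup>2 * r\<^sup>2 / 2)))"
    by (intro prod_mono_ennreal)
      (auto simp: coord_def nn_integral_exp_gauss_law[OF r] nn_integral_exp_sign_law_le)
  also have "\<dots> = ennreal (exp (t\<^sup>2 * (r\<^sup>2 * (\<Sum>l\<in>UNIV. (w l)\<^sup>2)) / 2))"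
    by (simp add: prod_ennreal exp_sum[symmetric] sum_distrib_left sum_divide_distrib power_mult_distrib mult_ac)
  finally show ?thesis .
qed

end

section \<open>The spiked design belongs to the class\<close>

text \<open>
  The denominator in the restricted eigenvalue runs over some of the coordinates, so the ordinary Rayleigh
  quotient is smaller. The cone condition makes \<open>\<delta>\<close> nonzero on \<open>S\<close>; thus the denominator does not vanish.
\<close>

lemma restricted_eigenvalue_of_quadratic_form:
  fixes A :: "real^'p^'p"
  assumes quad: "\<And>\<delta>. \<Phi> * (\<delta> \<bullet> \<delta>) \<le> \<delta> \<bullet> (A *v \<delta>)" and "\<Phi> \<ge> 0"
  shows "restricted_eigenvalue A s \<Phi>"
  unfolding restricted_eigenvalue_def re_const_def
proof (intro INF_greatest)
  fix S :: "'p set" and \<delta> :: "real^'p"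
  assume "\<delta> \<in> {\<delta>. \<delta> \<noteq> 0 \<and> (\<Sum>i\<in>- S. \<bar>\<delta> $ i\<bar>) \<le> (\<Sum>i\<in>S. \<bar>\<delta> $ i\<bar>)}"
  then have nz: "\<delta> \<noteq> 0" and cone: "(\<Sum>i\<in>- S. \<bar>\<delta> $ i\<bar>) \<le> (\<Sum>i\<in>S. \<bar>\<delta> $ i\<bar>)" by auto
  define D where "D = (\<Sum>i\<in>re_support s S \<delta>. (\<delta> $ i)\<^sup>2)"
  have "\<exists>i\<in>S. \<delta> $ i \<noteq> 0"
  proof (rule ccontr)
    assume "\<not> (\<exists>i\<in>S. \<delta> $ i \<noteq> 0)"
    then have S0: "\<And>i. i \<in> S \<Longrightarrow> \<delta> $ i = 0" by auto
    then have "(\<Sum>i\<in>- S. \<bar>\<delta> $ i\<bar>) \<le> 0" using cone by simp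
    moreover have "(\<Sum>i\<in>- S. \<bar>\<delta> $ i\<bar>) \<ge> 0" by (rule sum_nonneg) simp
    ultimately have "(\<Sum>i\<in>- S. \<bar>\<delta> $ i\<bar>) = 0" by linarith
    then have "\<And>i. i \<in> - S \<Longrightarrow> \<delta> $ i = 0" by (subst (asm) sum_nonneg_eq_0_iff) auto
    then have "\<delta> = 0" using S0 by (simp add: vec_eq_iff) blast
    then show False using nz by simp
  qed
  then obtain i where i: "i \<in> S" "\<delta> $ i \<noteq> 0" by blast
  have "0 < (\<delta> $ i)\<^sup>2" using i by simp
  also have "\<dots> \<le> D"
    unfolding D_def using i by (intro member_le_sum) (auto simp: re_support_def)
  finally have "D > 0" .
  have "D \<le> (\<Sum>i\<in>UNIV. (\<delta> $ i)\<^sup>2)" unfolding D_def by (rule sum_mono2) auto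
  also have "\<dots> = \<delta> \<bullet> \<delta>" by (simp add: inner_vec_def power2_eq_square)
  finally have "\<Phi> * D \<le> \<delta> \<bullet> (A *v \<delta>)"
    using quad[of \<delta>] \<open>\<Phi> \<ge> 0\<close> by (meson mult_left_mono order_trans)
  then show "ereal \<Phi> \<le> ereal (\<delta> \<bullet> (A *v \<delta>) / (\<Sum>i\<in>re_support s S \<delta>. (\<delta> $ i)\<^sup>2))"
    using \<open>D > 0\<close> by (simp add: D_def[symmetric] pos_le_divide_eq)
qed

text \<open>
  Independence of the error from the covariates reduces both conditional moments in the linear model to
  unconditional ones.
\<close>

lemma real_cond_exp_snd_pair:
  fixes M :: "(real^'p::finite) measure" and g :: "real \<Rightarrow> real"
  assumes "prob_space M" "prob_space N" and M: "sets M = sets borel" and N: "sets N = sets borel"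
    and g: "integrable N g"
  shows "AE z in M \<Otimes>\<^sub>M N. real_cond_exp (M \<Otimes>\<^sub>M N) (sigma_X (M \<Otimes>\<^sub>M N)) (\<lambda>z. g (snd z)) z = (\<integral>y. g y \<partial>N)"
proof -
  interpret M: prob_space M by fact
  interpret N: prob_space N by fact
  interpret MN: pair_prob_space M N ..
  note [measurable_cong] = M N
  define F where "F = sigma_X (M \<Otimes>\<^sub>M N)"
  have sp: "space M = UNIV" "space N = UNIV"
    using sets_eq_imp_space_eq[OF M] sets_eq_imp_space_eq[OF N] by simp_all
  have F: "sets F = {fst -` A \<inter> space (M \<Otimes>\<^sub>M N) | A. A \<in> sets borel}"
    unfolding F_def sigma_X_def by (subst sets_vimage_algebra2) auto
  have "subalgebra (M \<Otimes>\<^sub>M N) F"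
    unfolding subalgebra_def
  proof
    show "space F = space (M \<Otimes>\<^sub>M N)" by (simp add: F_def sigma_X_def)
    show "sets F \<subseteq> sets (M \<Otimes>\<^sub>M N)"
      unfolding F by (auto intro!: measurable_sets[where A = borel])
  qed
  then interpret finite_measure_subalgebra "M \<Otimes>\<^sub>M N" F
    by unfold_locales
  have g_snd: "integrable (M \<Otimes>\<^sub>M N) (\<lambda>z. g (snd z))"
  proof -
    have "integrable (distr (M \<Otimes>\<^sub>M N) N snd) g"
      using g by (simp add: distr_pair_snd assms(1,2))
    then show ?thesis by (subst (asm) integrable_distr_eq) (use g in auto)
  qed
  show ?thesis unfolding F_def[symmetric]
  proof (rule real_cond_exp_charact)
    fix B assume "B \<in> sets F"
    then obtain A where A[measurable]: "A \<in> sets borel" and B: "B = fst -` A \<inter> space (M \<Otimes>\<^sub>M N)"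
      unfolding F by auto
    have int: "integrable (M \<Otimes>\<^sub>M N) (\<lambda>z. indicator A (fst z) * h (snd z))"
      if "integrable (M \<Otimes>\<^sub>M N) (\<lambda>z. h (snd z))" for h :: "real \<Rightarrow> real"
    proof (rule Bochner_Integration.integrable_bound[OF that])
      show "(\<lambda>z. indicator A (fst z) * h (snd z)) \<in> borel_measurable (M \<Otimes>\<^sub>M N)"
        using borel_measurable_integrable[OF that] by measurable
    qed (auto simp: indicator_def)
    have prod: "(\<integral>z\<in>B. h (snd z) \<partial>(M \<Otimes>\<^sub>M N)) = measure M A * (\<integral>y. h y \<partial>N)"
      if "integrable (M \<Otimes>\<^sub>M N) (\<lambda>z. h (snd z))" for h :: "real \<Rightarrow> real"
    proof -
      have "(\<integral>z\<in>B. h (snd z) \<partial>(M \<Otimes>\<^sub>M N)) = (\<integral>z. indicator A (fst z) * h (snd z) \<partial>(M \<Otimes>\<^sub>M N))"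
        unfolding set_lebesgue_integral_def B
        by (intro Bochner_Integration.integral_cong refl) (auto simp: indicator_def)
      also have "\<dots> = (\<integral>x. \<integral>y. indicator A x * h y \<partial>N \<partial>M)"
        using MN.integral_fst'[OF int[OF that]] by simp
      also have "\<dots> = measure M A * (\<integral>y. h y \<partial>N)"
        using A M by simp
      finally show ?thesis .
    qed
    show "(\<integral>z\<in>B. g (snd z) \<partial>(M \<Otimes>\<^sub>M N)) = (\<integral>z\<in>B. (\<integral>y. g y \<partial>N) \<partial>(M \<Otimes>\<^sub>M N))"
      using prod[OF g_snd] prod[of "\<lambda>_. \<integral>y. g y \<partial>N"] by (simp add: N.prob_space)
  qed (use g_snd in auto)
qed

context spiked_design
begin

lemma inner_design:
  "u \<bullet> design S \<omega> = (\<Sum>l\<in>UNIV. (u $ l + (if l \<in> S then \<theta> * u $ j else 0)) * \<omega> l)"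
proof -
  have "u \<bullet> design S \<omega> = (\<Sum>l\<in>UNIV. u $ l * \<omega> l) + u $ j * (\<theta> * (\<Sum>i\<in>S. \<omega> i))"
  proof -
    have "u \<bullet> design S \<omega> = (\<Sum>l\<in>UNIV. u $ l * \<omega> l + (if l = j then u $ j * (\<theta> * (\<Sum>i\<in>S. \<omega> i)) else 0))"
      unfolding inner_vec_def design_def by (intro sum.cong) (auto simp: distrib_left)
    then show ?thesis by (simp add: sum.distrib)
  qed
  also have "u $ j * (\<theta> * (\<Sum>i\<in>S. \<omega> i)) = (\<Sum>l\<in>S. \<theta> * u $ j * \<omega> l)"
    by (simp add: sum_distrib_left mult_ac)
  also have "\<dots> = (\<Sum>l\<in>UNIV. if l \<in> S then \<theta> * u $ j * \<omega> l else 0)"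
    by (simp add: sum.If_cases)
  finally show ?thesis
    by (simp add: sum.distrib[symmetric] distrib_right if_distrib cong: if_cong)
      (intro sum.cong, auto simp: distrib_right)
qed

text \<open>
  Up to the factor \<open>r\<^sup>2\<close>, the sum is the variance of \<open>u \<bullet> X\<close>. The cross term \<open>2 \<theta> u\<^sub>j \<Sum>i\<in>S. u\<^sub>i\<close> is at most a
  quarter of \<open>u \<bullet> u\<close> in absolute value, and the term of second order in \<open>\<theta>\<close> lies between \<open>0\<close> and a sixteenth of it.
\<close>

lemma sum_weights_bounds:
  assumes "j \<notin> S" and "\<theta>\<^sup>2 * real (card S) \<le> 1/16"
  shows "3/4 * (u \<bullet> u) \<le> (\<Sum>l\<in>UNIV. (u $ l + (if l \<in> S then \<theta> * u $ j else 0))\<^sup>2)"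
    and "(\<Sum>l\<in>UNIV. (u $ l + (if l \<in> S then \<theta> * u $ j else 0))\<^sup>2) \<le> 21/16 * (u \<bullet> u)"
proof -
  define T where "T = (\<Sum>l\<in>S. u $ l)"
  define V where "V = (\<Sum>l\<in>S. (u $ l)\<^sup>2)"
  define q where "q = \<theta>\<^sup>2 * real (card S)"
  define W where "W = (\<Sum>l\<in>UNIV. (u $ l + (if l \<in> S then \<theta> * u $ j else 0))\<^sup>2)"
  have q: "0 \<le> q" "q \<le> 1/16" using assms by (simp_all add: q_def)
  have "(u $ l + (if l \<in> S then \<theta> * u $ j else 0))\<^sup>2 =
      (u $ l)\<^sup>2 + (if l \<in> S then 2 * \<theta> * u $ j * u $ l + \<theta>\<^sup>2 * (u $ j)\<^sup>2 else 0)" for l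
    by (simp add: power2_eq_square algebra_simps)
  then have "W = (\<Sum>l\<in>UNIV. (u $ l)\<^sup>2) + (\<Sum>l\<in>S. 2 * \<theta> * u $ j * u $ l + \<theta>\<^sup>2 * (u $ j)\<^sup>2)"
    by (simp add: W_def sum.distrib sum.If_cases)
  also have "(\<Sum>l\<in>UNIV. (u $ l)\<^sup>2) = u \<bullet> u" by (simp add: inner_vec_def power2_eq_square)
  also have "(\<Sum>l\<in>S. 2 * \<theta> * u $ j * u $ l + \<theta>\<^sup>2 * (u $ j)\<^sup>2) = 2 * (\<theta> * T) * u $ j + q * (u $ j)\<^sup>2"
    by (simp add: sum.distrib T_def q_def sum_distrib_left mult_ac)
  finally have W: "W = u \<bullet> u + (2 * (\<theta> * T) * u $ j + q * (u $ j)\<^sup>2)" .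
  have V: "V \<ge> 0" unfolding V_def by (rule sum_nonneg) simp
  have "T\<^sup>2 \<le> real (card S) * V"
    unfolding T_def V_def using sum_squared_le_sum_of_squares[of "\<lambda>l. u $ l" S]
    by (cases "S = {}") (simp_all add: mult.commute)
  then have "\<theta>\<^sup>2 * T\<^sup>2 \<le> \<theta>\<^sup>2 * (real (card S) * V)" by (rule mult_left_mono) simp
  also have "\<dots> = q * V" by (simp add: q_def)
  also have "\<dots> \<le> 1/16 * V" using q V by (intro mult_right_mono) auto
  finally have T: "(\<theta> * T)\<^sup>2 \<le> V / 16" by (simp add: power_mult_distrib)
  have "(u $ j)\<^sup>2 + V = (\<Sum>l\<in>insert j S. (u $ l)\<^sup>2)" using assms by (simp add: V_def)
  also have "\<dots> \<le> (\<Sum>l\<in>UNIV. (u $ l)\<^sup>2)" by (rule sum_mono2) auto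
  also have "\<dots> = u \<bullet> u" by (simp add: inner_vec_def power2_eq_square)
  finally have jV: "(u $ j)\<^sup>2 + V \<le> u \<bullet> u" .
  have "0 \<le> (2 * (\<theta> * T) - u $ j / 2)\<^sup>2" "0 \<le> (2 * (\<theta> * T) + u $ j / 2)\<^sup>2" by simp_all
  then have "2 * (\<theta> * T) * u $ j \<le> (u $ j)\<^sup>2 / 4 + 4 * (\<theta> * T)\<^sup>2"
     "- ((u $ j)\<^sup>2 / 4 + 4 * (\<theta> * T)\<^sup>2) \<le> 2 * (\<theta> * T) * u $ j"
    by (simp_all add: power2_eq_square algebra_simps)
  moreover have "0 \<le> q * (u $ j)\<^sup>2" "q * (u $ j)\<^sup>2 \<le> 1/16 * (u $ j)\<^sup>2"
    using q(1) mult_right_mono[OF q(2), of "(u $ j)\<^sup>2"] by simp_all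
  ultimately show "3/4 * (u \<bullet> u) \<le> W" "W \<le> 21/16 * (u \<bullet> u)"
    unfolding W using T jV V zero_le_power2[of "u $ j"] by linarith+
qed

lemma distr_law_fst: "distr (law (mech S)) borel fst = distr latent borel (design S)"
proof -
  interpret G: prob_space "gauss_law R" by (rule prob_space_gauss)
  have "distr (law (mech S)) borel fst = distr (law (mech S)) (distr latent borel (design S)) fst"
    by (rule distr_cong) auto
  then show ?thesis by (simp add: G.distr_pair_fst)
qed

lemma distr_law_snd: "distr (law (mech S)) borel snd = gauss_law R"
proof -
  have "distr (law (mech S)) borel snd = distr (law (mech S)) (gauss_law R) snd"
    by (rule distr_cong) auto
  then show ?thesis by (simp add: distr_pair_snd prob_space_design prob_space_gauss)
qed

lemma sets_law: "sets (law (mech S)) = sets borel"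
proof -
  have "sets (law (mech S)) = sets (borel \<Otimes>\<^sub>M borel :: ((real^'p) \<times> real) measure)"
    by (simp only: mech_simps) (intro sets_pair_measure_cong, simp_all)
  then show ?thesis by (simp only: borel_prod)
qed

lemma linear_model_mech: "linear_model (mech S)"
proof -
  let ?L = "law (mech S)"
  have meas [measurable]: "snd \<in> borel_measurable ?L"
    using measurable_cong_sets[OF sets_law refl] borel_measurable_continuous_onI[OF continuous_on_snd[OF continuous_on_id]]
    by (metis borel_prod measurable_snd)
  have int1: "integrable ?L (\<lambda>z. h (snd z))" if "integrable (gauss_law R) h" for h :: "real \<Rightarrow> real"
  proof -
    have "h \<in> borel_measurable borel" using borel_measurable_integrable[OF that] by simp
    then show ?thesis
      using that integrable_distr_eq[OF meas, of h] by (simp only: distr_law_snd)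
  qed
  have cond: "AE z in ?L. real_cond_exp ?L (sigma_X ?L) (\<lambda>z. h (snd z)) z = (\<integral>y. h y \<partial>gauss_law R)"
    if "integrable (gauss_law R) h" for h :: "real \<Rightarrow> real"
    unfolding mech_simps using that
    by (intro real_cond_exp_snd_pair prob_space_design prob_space_gauss) auto
  have m1: "AE z in ?L. real_cond_exp ?L (sigma_X ?L) snd z = 0"
    using cond[OF integrable_gauss_law[OF R]] by (simp only: integral_gauss_law[OF R])
  have m2: "AE z in ?L. real_cond_exp ?L (sigma_X ?L) (\<lambda>z. (snd z)\<^sup>2) z = R\<^sup>2"
    using cond[OF integrable_gauss_law_square[OF R]] by (simp only: integral_gauss_law_square[OF R])
  interpret L: prob_space ?L by (rule prob_space_law)
  have "fst \<in> measurable ?L borel"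
    using measurable_cong_sets[OF sets_law refl] by (metis borel_prod measurable_fst)
  then have "subalgebra ?L (sigma_X ?L)"
    unfolding subalgebra_def sigma_X_def
    by (auto simp: sets_vimage_algebra2 simp del: mech_simps intro: measurable_sets)
  then interpret F: finite_measure_subalgebra ?L "sigma_X ?L"
    by unfold_locales
  have "AE z in ?L. real_cond_exp ?L (sigma_X ?L) (\<lambda>\<omega>. (snd \<omega> - real_cond_exp ?L (sigma_X ?L) snd \<omega>)\<^sup>2) z =
      real_cond_exp ?L (sigma_X ?L) (\<lambda>z. (snd z)\<^sup>2) z"
    by (rule F.real_cond_exp_cong, use m1 in eventually_elim) (auto simp del: mech_simps)
  with m2 have "AE z in ?L. real_cond_var ?L (sigma_X ?L) snd z = R\<^sup>2"
    unfolding real_cond_var_def by eventually_elim simp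
  then show ?thesis
    unfolding linear_model_def
    using m1 prob_space_law sets_law R int1[OF integrable_gauss_law[OF R]] int1[OF integrable_gauss_law_square[OF R]]
    by (simp del: mech_simps(1))
qed

lemma design_nth:
  "design S \<omega> $ l = (\<Sum>k\<in>UNIV. (axis l 1 $ k + (if k \<in> S then \<theta> * axis l 1 $ j else 0)) * \<omega> k)"
  by (subst inner_design[symmetric]) (simp add: inner_axis')

lemma integrable_design_mult: "integrable latent (\<lambda>\<omega>. design S \<omega> $ l * design S \<omega> $ k)"
  unfolding design_nth by (rule integrable_linear_mult)

lemma quadratic_form_second_moment:
  "u \<bullet> (second_moment (law (mech S)) fst *v u) =
    r\<^sup>2 * (\<Sum>l\<in>UNIV. (u $ l + (if l \<in> S then \<theta> * u $ j else 0))\<^sup>2)"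
proof -
  have fst: "fst \<in> measurable (law (mech S)) borel"
    using measurable_cong_sets[OF sets_law refl] by (metis borel_prod measurable_fst)
  have sm: "second_moment (law (mech S)) fst $ l $ k = (\<integral>\<omega>. design S \<omega> $ l * design S \<omega> $ k \<partial>latent)" for l k
  proof -
    have "second_moment (law (mech S)) fst $ l $ k = (\<integral>x. x $ l * x $ k \<partial>distr (law (mech S)) borel fst)"
      unfolding second_moment_def by (subst integral_distr[OF fst]) simp_all
    also have "\<dots> = (\<integral>\<omega>. design S \<omega> $ l * design S \<omega> $ k \<partial>latent)"
      unfolding distr_law_fst by (subst integral_distr) simp_all
    finally show ?thesis .
  qed
  have "u \<bullet> (second_moment (law (mech S)) fst *v u) =
      (\<Sum>l\<in>UNIV. \<Sum>k\<in>UNIV. u $ l * u $ k * (\<integral>\<omega>. design S \<omega> $ l * design S \<omega> $ k \<partial>latent))"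
    by (simp add: inner_vec_def matrix_vector_mult_def sm sum_distrib_left mult_ac del: mech_simps)
  also have "\<dots> = (\<integral>\<omega>. (\<Sum>l\<in>UNIV. \<Sum>k\<in>UNIV. u $ l * u $ k * (design S \<omega> $ l * design S \<omega> $ k)) \<partial>latent)"
    by (simp add: Bochner_Integration.integral_sum integrable_design_mult)
  also have "\<dots> = (\<integral>\<omega>. (u \<bullet> design S \<omega>)\<^sup>2 \<partial>latent)"
    by (simp add: inner_vec_def power2_eq_square sum_product mult_ac)
  also have "\<dots> = r\<^sup>2 * (\<Sum>l\<in>UNIV. (u $ l + (if l \<in> S then \<theta> * u $ j else 0))\<^sup>2)"
    unfolding inner_design by (rule integral_linear_square)
  finally show ?thesis .
qed

lemma inner_beta:
  assumes "j \<notin> S"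
  shows "y \<bullet> beta (mech S) = b * y $ j - b * \<theta> * (\<Sum>l\<in>S. y $ l)"
proof -
  have "y \<bullet> beta (mech S) = (\<Sum>l\<in>UNIV. (if l = j then b * y $ l else 0) + (if l \<in> S then - (b * \<theta> * y $ l) else 0))"
    unfolding inner_vec_def using assms by (intro sum.cong) auto
  also have "\<dots> = b * y $ j + (\<Sum>l\<in>S. - (b * \<theta> * y $ l))"
    by (simp add: sum.distrib sum.If_cases)
  finally show ?thesis by (simp add: sum_negf sum_distrib_left)
qed

lemma inner_beta_beta:
  assumes "j \<notin> S"
  shows "beta (mech S) \<bullet> beta (mech S) = b\<^sup>2 + (b * \<theta>)\<^sup>2 * real (card S)"
proof -
  have "(\<Sum>l\<in>S. beta (mech S) $ l) = (\<Sum>l\<in>S. - b * \<theta>)"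
    using assms by (intro sum.cong) auto
  moreover have "beta (mech S) $ j = b" by simp
  ultimately show ?thesis
    unfolding inner_beta[OF assms] by (simp add: power2_eq_square algebra_simps)
qed

text \<open>
  With \<open>r = R\<^sub>X / 2\<close> the two bounds of \<open>sum_weights_bounds\<close> become \<open>3 R\<^sub>X\<^sup>2 / 16\<close> and \<open>21 R\<^sub>X\<^sup>2 / 64 \<le> 3 R\<^sub>X\<^sup>2 / 8\<close>.
\<close>

lemma mech_in_P_HD:
  assumes S: "j \<notin> S" and small: "\<theta>\<^sup>2 * real (card S) \<le> 1/16" and card: "card S + 1 \<le> s"
    and RX: "R\<^sub>X = 2 * r" and \<Phi>: "0 \<le> \<Phi>" "\<Phi> \<le> 3 * R\<^sub>X\<^sup>2 / 16"
    and B: "B \<ge> 0" "17/16 * b\<^sup>2 \<le> B\<^sup>2"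
  shows "mech S \<in> P_HD R\<^sub>X R B s \<Phi>"
proof -
  let ?L = "law (mech S)"
  have fst [measurable]: "fst \<in> measurable ?L borel" and snd [measurable]: "snd \<in> measurable ?L borel"
    using measurable_cong_sets[OF sets_law refl] by (metis borel_prod measurable_fst measurable_snd)+
  interpret L: prob_space ?L by (rule prob_space_law)
  have RX0: "R\<^sub>X > 0" using RX r by simp
  have r2: "r\<^sup>2 = R\<^sub>X\<^sup>2 / 4" using RX by (simp add: power_mult_distrib)
  have int_nth: "integrable latent (\<lambda>\<omega>. design S \<omega> $ l)" for l
    unfolding design_nth by (intro Bochner_Integration.integrable_sum integrable_mult_right integrable_latent)
  have "integrable latent (design S)"
  proof -
    have "design S = (\<lambda>\<omega>. \<Sum>l\<in>UNIV. (design S \<omega> $ l) *\<^sub>R axis l 1)"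
      using basis_expansion[of "design S _"] by (simp add: fun_eq_iff scalar_mult_eq_scaleR)
    then show ?thesis
      by (subst \<open>design S = _\<close>) (intro Bochner_Integration.integrable_sum integrable_scaleR_left int_nth)
  qed
  note int = this
  have int_fst: "integrable ?L fst"
    using integrable_distr_eq[OF fst, of "\<lambda>x. x"] integrable_distr_eq[OF measurable_design, of "\<lambda>x. x" S] int
    by (simp only: distr_law_fst) simp
  have "(\<integral>z. fst z \<partial>?L) = (\<integral>\<omega>. design S \<omega> \<partial>latent)"
    using integral_distr[OF fst, of "\<lambda>x. x"] integral_distr[OF measurable_design, of "\<lambda>x. x" S]
    by (simp only: distr_law_fst) simp
  also have "\<dots> = 0"
  proof (rule vec_eq_iff[THEN iffD2], rule allI)
    fix l
    have "(\<integral>\<omega>. design S \<omega> \<partial>latent) $ l = (\<integral>\<omega>. design S \<omega> $ l \<partial>latent)"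
      using integral_bounded_linear[OF bounded_linear_vec_nth[of l] int] by simp
    also have "\<dots> = 0"
      unfolding design_nth by (simp add: Bochner_Integration.integral_sum integrable_latent integral_latent)
    finally show "(\<integral>\<omega>. design S \<omega> \<partial>latent) $ l = 0 $ l" by simp
  qed
  finally have mean: "(\<integral>z. fst z \<partial>?L) = 0" .
  have "psi2_norm ?L (\<lambda>z. u \<bullet> fst z) \<le> ennreal R\<^sub>X" if u: "norm u = 1" for u
  proof (rule psi2_norm_le_of_mgf[OF prob_space_law _ RX0])
    let ?v = "r\<^sup>2 * (\<Sum>l\<in>UNIV. (u $ l + (if l \<in> S then \<theta> * u $ j else 0))\<^sup>2)"
    show "(\<lambda>z. u \<bullet> fst z) \<in> borel_measurable ?L" by measurable
    have uu: "u \<bullet> u = 1" using u by (simp add: norm_eq_sqrt_inner)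
    have "?v \<le> r\<^sup>2 * (21/16 * (u \<bullet> u))"
      by (rule mult_left_mono[OF sum_weights_bounds(2)[OF S small]]) simp
    also have "\<dots> \<le> 3 * R\<^sub>X\<^sup>2 / 8"
      unfolding uu r2 by simp
    finally show "?v \<le> 3 * R\<^sub>X\<^sup>2 / 8" .
    fix t
    have "(\<integral>\<^sup>+z. ennreal (exp (t * (u \<bullet> fst z))) \<partial>?L) =
        (\<integral>\<^sup>+x. ennreal (exp (t * (u \<bullet> x))) \<partial>distr ?L borel fst)"
      by (rule nn_integral_distr[symmetric, OF fst]) measurable
    also have "\<dots> = (\<integral>\<^sup>+\<omega>. ennreal (exp (t * (u \<bullet> design S \<omega>))) \<partial>latent)"
      unfolding distr_law_fst by (rule nn_integral_distr) measurable
    also have "\<dots> \<le> ennreal (exp (t\<^sup>2 * ?v / 2))"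
      unfolding inner_design by (rule nn_integral_exp_linear_le)
    finally show "(\<integral>\<^sup>+z. ennreal (exp (t * (u \<bullet> fst z))) \<partial>?L) \<le> ennreal (exp (t\<^sup>2 * ?v / 2))" .
  qed
  then have psi: "psi2_norm_vec ?L fst \<le> ennreal R\<^sub>X"
    unfolding psi2_norm_vec_def by (intro SUP_least) auto
  have "(\<integral>\<^sup>+z. ennreal (exp (t * snd z)) \<partial>?L) = ennreal (exp (t\<^sup>2 * R\<^sup>2 / 2))" for t
  proof -
    have "(\<integral>\<^sup>+z. ennreal (exp (t * snd z)) \<partial>?L) = (\<integral>\<^sup>+x. ennreal (exp (t * x)) \<partial>distr ?L borel snd)"
      by (rule nn_integral_distr[symmetric, OF snd]) measurable
    then show ?thesis unfolding distr_law_snd using nn_integral_exp_gauss_law[OF R] by simp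
  qed
  then have sub: "sub_gaussian ?L snd R" unfolding sub_gaussian_def by simp
  have re: "restricted_eigenvalue (second_moment ?L fst) s \<Phi>"
  proof (rule restricted_eigenvalue_of_quadratic_form[OF _ \<Phi>(1)])
    fix u :: "real^'p"
    have "\<Phi> * (u \<bullet> u) \<le> r\<^sup>2 * (3/4 * (u \<bullet> u))"
      using mult_right_mono[OF \<Phi>(2), of "u \<bullet> u"] by (simp add: r2)
    also have "\<dots> \<le> u \<bullet> (second_moment ?L fst *v u)"
      unfolding quadratic_form_second_moment
      by (intro mult_left_mono sum_weights_bounds(1)[OF S small]) simp
    finally show "\<Phi> * (u \<bullet> u) \<le> u \<bullet> (second_moment ?L fst *v u)" .
  qed
  have "{i. beta (mech S) $ i \<noteq> 0} \<subseteq> insert j S" by auto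
  then have "l0 (beta (mech S)) \<le> card (insert j S)" unfolding l0_def by (rule card_mono[rotated]) simp
  then have l0: "l0 (beta (mech S)) \<le> s" using card by (simp add: card_insert_if split: if_splits)
  have "beta (mech S) \<bullet> beta (mech S) = b\<^sup>2 + (b * \<theta>)\<^sup>2 * real (card S)"
    by (rule inner_beta_beta[OF S])
  also have "\<dots> = b\<^sup>2 * (1 + \<theta>\<^sup>2 * real (card S))" by (simp add: power_mult_distrib algebra_simps)
  also have "\<dots> \<le> b\<^sup>2 * (17/16)" using small by (intro mult_left_mono) auto
  also have "\<dots> \<le> B\<^sup>2" using B by simp
  finally have "norm (beta (mech S)) \<le> B"
    using B(1) by (simp add: norm_eq_sqrt_inner real_le_lsqrt del: mech_simps)
  then show ?thesis
    unfolding P_HD_def using linear_model_mech int_fst mean psi sub re l0 by (simp del: mech_simps(1,2))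
qed

end

section \<open>Likelihood ratios for a single observation\<close>

lemma ennreal_half_add:
  assumes "x \<ge> 0" "y \<ge> 0"
  shows "ennreal ((x + y) / 2) = ennreal (1 / 2) * (ennreal x + ennreal y)"
proof -
  have "ennreal (1 / 2) * (ennreal x + ennreal y) = ennreal (1 / 2 * (x + y))"
    using assms by (subst ennreal_plus[symmetric], simp, simp, subst ennreal_mult[symmetric]) simp_all
  then show ?thesis by simp
qed

context spiked_design
begin

definition base :: "(('p \<Rightarrow> real) \<times> real) measure" where
  "base = latent \<Otimes>\<^sub>M gauss_law R"

text \<open>
  What a labelled observation with observed set \<open>Ob\<close> shows of the latent pair \<open>(\<omega>, \<epsilon>)\<close>.
\<close>

definition obs :: "'p set \<Rightarrow> 'p set \<Rightarrow> ('p \<Rightarrow> real) \<times> real \<Rightarrow> ('p \<Rightarrow> real) \<times> real" where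
  "obs S Ob z = (\<lambda>l\<in>Ob. design S (fst z) $ l, b * fst z j + snd z)"

text \<open>
  Adding the index \<open>i\<close> to \<open>S\<close> has the same effect on all observations as this change of the latent pair when
  \<open>\<tau> = \<theta>\<close>: coordinate \<open>j\<close> moves, and the error compensates for it so that the response \<open>b \<omega>\<^sub>j + \<epsilon>\<close> stays put.
\<close>

definition shift :: "'p \<Rightarrow> real \<Rightarrow> ('p \<Rightarrow> real) \<times> real \<Rightarrow> ('p \<Rightarrow> real) \<times> real" where
  "shift i \<tau> z = ((fst z)(j := fst z j + \<tau> * fst z i), snd z - b * \<tau> * fst z i)"

text \<open>
  The derivative at \<open>t = 0\<close> of the log-likelihood of the translate of \<open>(\<omega>\<^sub>j, \<epsilon>)\<close> by \<open>t (1, - b)\<close>; the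
  corresponding Fisher information is \<open>info\<close>.
\<close>

definition score :: "('p \<Rightarrow> real) \<times> real \<Rightarrow> real" where
  "score z = fst z j / r\<^sup>2 - b * snd z / R\<^sup>2"

definition info :: real where
  "info = 1 / r\<^sup>2 + b\<^sup>2 / R\<^sup>2"

text \<open>
  The density of the law of \<open>shift i \<tau>\<close>, see \<open>distr_shift\<close>.
\<close>

definition tilt :: "'p \<Rightarrow> real \<Rightarrow> ('p \<Rightarrow> real) \<times> real \<Rightarrow> real" where
  "tilt i \<tau> z = exp (\<tau> * fst z i * score z - (\<tau> * fst z i)\<^sup>2 * info / 2)"

text \<open>
  The law obtained when coordinate \<open>j\<close> is shifted by an independent sign instead of by a coordinate
  \<open>\<omega>\<^sub>i\<close>. It does not depend on \<open>i\<close>, so it serves all hypotheses of a block at once.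
\<close>

definition reference :: "(('p \<Rightarrow> real) \<times> real) measure" where
  "reference = density base (\<lambda>z. ennreal (cosh (\<theta> * r * score z) * exp (- (\<theta> * r)\<^sup>2 * info / 2)))"

lemma sets_base: "sets base = sets (PiM UNIV (\<lambda>_. borel) \<Otimes>\<^sub>M borel)"
  unfolding base_def by (intro sets_pair_measure_cong sets_latent) simp

lemma space_base [simp]: "space base = UNIV"
  by (simp add: base_def space_pair_measure)

lemma prob_space_base: "prob_space base"
  unfolding base_def by (intro prob_space_pair prob_space_latent prob_space_gauss)

lemma measurable_base_snd [measurable]: "snd \<in> borel_measurable base"
  unfolding base_def by measurable

lemma measurable_base_fst [measurable]: "fst \<in> measurable base latent"
  unfolding base_def by measurable

lemma measurable_base_component: "(\<lambda>z. fst z l) \<in> borel_measurable base"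
  by (rule measurable_compose[OF measurable_base_fst measurable_latent_component])

lemma measurable_score [measurable]: "score \<in> borel_measurable base"
proof -
  note [measurable] = measurable_base_component
  show ?thesis unfolding score_def by measurable
qed

lemma measurable_tilt [measurable]: "tilt i \<tau> \<in> borel_measurable base"
proof -
  note [measurable] = measurable_base_component
  show ?thesis unfolding tilt_def by measurable
qed

lemma tilt_pos: "tilt i \<tau> z > 0"
  by (simp add: tilt_def)

lemma measurable_obs [measurable]: "obs S Ob \<in> measurable base (PiM Ob (\<lambda>_. borel) \<Otimes>\<^sub>M borel)"
proof -
  note [measurable] = measurable_base_component
  show ?thesis unfolding obs_def by measurable
qed

lemma measurable_shift [measurable]: "shift i \<tau> \<in> measurable base base"
proof -
  note [measurable] = measurable_base_component
  have "(\<lambda>z. (fst z)(j := fst z j + \<tau> * fst z i)) \<in> measurable base (PiM UNIV (\<lambda>_. borel))"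
    unfolding fun_upd_def by (rule measurable_PiM_single') (auto intro: measurable_base_component)
  then have "(\<lambda>z. (fst z)(j := fst z j + \<tau> * fst z i)) \<in> measurable base latent"
    using measurable_cong_sets[OF refl sets_latent] by blast
  moreover have "(\<lambda>z. snd z - b * \<tau> * fst z i) \<in> measurable base (gauss_law R)"
    by measurable
  ultimately show ?thesis
    unfolding shift_def by (subst (2) base_def) (rule measurable_Pair)
qed

lemma nn_integral_base_split:
  assumes [measurable]: "F \<in> borel_measurable base"
  shows "(\<integral>\<^sup>+z. F z \<partial>base) =
    (\<integral>\<^sup>+x. \<integral>\<^sup>+y. \<integral>\<^sup>+e. F (x(l := y), e) \<partial>gauss_law R \<partial>coord l \<partial>PiM (UNIV - {l}) coord)"
proof -
  interpret coord: product_prob_space coord by (rule product_prob_space_coord)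
  interpret G: prob_space "gauss_law R" by (rule prob_space_gauss)
  have U: "insert l (UNIV - {l}) = UNIV" by auto
  have [measurable]: "F \<in> borel_measurable (PiM UNIV coord \<Otimes>\<^sub>M gauss_law R)"
    using assms by (simp add: base_def latent_def)
  have "(\<integral>\<^sup>+z. F z \<partial>base) = (\<integral>\<^sup>+\<omega>. \<integral>\<^sup>+e. F (\<omega>, e) \<partial>gauss_law R \<partial>PiM (insert l (UNIV - {l})) coord)"
    unfolding U base_def latent_def by (rule G.nn_integral_fst[symmetric]) measurable
  also have "\<dots> = (\<integral>\<^sup>+x. \<integral>\<^sup>+y. \<integral>\<^sup>+e. F (x(l := y), e) \<partial>gauss_law R \<partial>coord l \<partial>PiM (UNIV - {l}) coord)"
    by (rule coord.product_nn_integral_insert) (unfold U, auto)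
  finally show ?thesis .
qed

text \<open>
  The Cameron-Martin formula applied to the error and then to coordinate \<open>j\<close>; the two exponents add up.
\<close>

lemma nn_integral_gauss_pair_shift:
  assumes [measurable]: "H \<in> borel_measurable (borel \<Otimes>\<^sub>M borel)"
  shows "(\<integral>\<^sup>+y. \<integral>\<^sup>+e. H (y + t, e - b * t) \<partial>gauss_law R \<partial>gauss_law r) =
    (\<integral>\<^sup>+y. \<integral>\<^sup>+e. H (y, e) * ennreal (exp (t * (y / r\<^sup>2 - b * e / R\<^sup>2) - t\<^sup>2 * info / 2)) \<partial>gauss_law R \<partial>gauss_law r)"
proof -
  interpret G: prob_space "gauss_law R" by (rule prob_space_gauss)
  define E1 where "E1 y = ennreal (exp (t * y / r\<^sup>2 - t\<^sup>2 / (2 * r\<^sup>2)))" for y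
  define E2 where "E2 e = ennreal (exp ((- (b * t)) * e / R\<^sup>2 - (- (b * t))\<^sup>2 / (2 * R\<^sup>2)))" for e
  have [measurable]: "E1 \<in> borel_measurable borel" "E2 \<in> borel_measurable borel"
    unfolding E1_def E2_def by measurable
  have E: "E2 e * E1 y = ennreal (exp (t * (y / r\<^sup>2 - b * e / R\<^sup>2) - t\<^sup>2 * info / 2))" for y e
  proof -
    have "((- (b * t)) * e / R\<^sup>2 - (- (b * t))\<^sup>2 / (2 * R\<^sup>2)) + (t * y / r\<^sup>2 - t\<^sup>2 / (2 * r\<^sup>2)) =
        t * (y / r\<^sup>2 - b * e / R\<^sup>2) - t\<^sup>2 * info / 2"
      using r R by (simp add: info_def field_simps power2_eq_square)
    then show ?thesis unfolding E1_def E2_def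
      by (simp add: ennreal_mult[symmetric] exp_add[symmetric] del: mult_minus_left)
  qed
  have "(\<integral>\<^sup>+y. \<integral>\<^sup>+e. H (y + t, e - b * t) \<partial>gauss_law R \<partial>gauss_law r) =
      (\<integral>\<^sup>+y. \<integral>\<^sup>+e. H (y + t, e) * E2 e \<partial>gauss_law R \<partial>gauss_law r)"
    unfolding E2_def
    by (subst nn_integral_gauss_law_shift[OF R, symmetric]) simp_all
  also have "\<dots> = (\<integral>\<^sup>+y. (\<integral>\<^sup>+e. H (y, e) * E2 e \<partial>gauss_law R) * E1 y \<partial>gauss_law r)"
    unfolding E1_def
    by (subst nn_integral_gauss_law_shift[OF r, symmetric]) simp_all
  also have "\<dots> = (\<integral>\<^sup>+y. \<integral>\<^sup>+e. H (y, e) * (E2 e * E1 y) \<partial>gauss_law R \<partial>gauss_law r)"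
    by (subst nn_integral_multc[symmetric]) (simp_all add: mult.assoc)
  finally show ?thesis unfolding E .
qed

text \<open>
  Given all coordinates other than \<open>j\<close>, the shift is a translation of a Gaussian pair by a constant vector.
\<close>

lemma nn_integral_shift:
  assumes i: "i \<noteq> j" and F[measurable]: "F \<in> borel_measurable base"
  shows "(\<integral>\<^sup>+z. F (shift i \<tau> z) \<partial>base) = (\<integral>\<^sup>+z. F z * ennreal (tilt i \<tau> z) \<partial>base)"
proof -
  have cj: "coord j = gauss_law r" by (simp add: coord_def)
  have "(\<integral>\<^sup>+y. \<integral>\<^sup>+e. F (shift i \<tau> (x(j := y), e)) \<partial>gauss_law R \<partial>coord j) =
      (\<integral>\<^sup>+y. \<integral>\<^sup>+e. F (x(j := y), e) * ennreal (tilt i \<tau> (x(j := y), e)) \<partial>gauss_law R \<partial>coord j)"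
    if x: "x \<in> space (PiM (UNIV - {j}) coord)" for x
  proof -
    define H where "H = (\<lambda>(y, e). F (x(j := y), e))"
    have "(\<lambda>p. (x(j := fst p), snd p)) \<in> measurable (borel \<Otimes>\<^sub>M borel) (PiM UNIV (\<lambda>_. borel) \<Otimes>\<^sub>M borel)"
    proof (rule measurable_Pair)
      show "(\<lambda>p. x(j := fst p)) \<in> measurable (borel \<Otimes>\<^sub>M borel) (PiM UNIV (\<lambda>_. borel))"
        unfolding fun_upd_def by (rule measurable_PiM_single') auto
    qed simp
    moreover have "F \<in> borel_measurable (PiM UNIV (\<lambda>_. borel) \<Otimes>\<^sub>M borel)"
      using F measurable_cong_sets[OF sets_base refl] by blast
    ultimately have "(\<lambda>p. F (x(j := fst p), snd p)) \<in> borel_measurable (borel \<Otimes>\<^sub>M borel)"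
      by (rule measurable_compose)
    then have H: "H \<in> borel_measurable (borel \<Otimes>\<^sub>M borel)"
      unfolding H_def by (simp add: case_prod_unfold)
    show ?thesis
      using nn_integral_gauss_pair_shift[OF H, of "\<tau> * x i"] i
      unfolding cj H_def shift_def tilt_def score_def by (simp add: mult_ac)
  qed
  moreover have "(\<integral>\<^sup>+z. F (shift i \<tau> z) \<partial>base) = (\<integral>\<^sup>+x. \<integral>\<^sup>+y. \<integral>\<^sup>+e. F (shift i \<tau> (x(j := y), e))
      \<partial>gauss_law R \<partial>coord j \<partial>PiM (UNIV - {j}) coord)"
    by (rule nn_integral_base_split) measurable
  moreover have "(\<integral>\<^sup>+z. F z * ennreal (tilt i \<tau> z) \<partial>base) = (\<integral>\<^sup>+x. \<integral>\<^sup>+y. \<integral>\<^sup>+e. F (x(j := y), e) *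
      ennreal (tilt i \<tau> (x(j := y), e)) \<partial>gauss_law R \<partial>coord j \<partial>PiM (UNIV - {j}) coord)"
    by (rule nn_integral_base_split) measurable
  ultimately show ?thesis by (simp cong: nn_integral_cong)
qed

lemma distr_shift:
  assumes "i \<noteq> j"
  shows "distr base base (shift i \<tau>) = density base (\<lambda>z. ennreal (tilt i \<tau> z))"
proof (rule measure_eqI)
  fix A assume "A \<in> sets (distr base base (shift i \<tau>))"
  then have A[measurable]: "A \<in> sets base" by simp
  have "emeasure (distr base base (shift i \<tau>)) A = (\<integral>\<^sup>+z. indicator A z \<partial>distr base base (shift i \<tau>))"
    by simp
  also have "\<dots> = (\<integral>\<^sup>+z. indicator A (shift i \<tau> z) \<partial>base)"
    by (rule nn_integral_distr) measurable
  also have "\<dots> = (\<integral>\<^sup>+z. indicator A z * ennreal (tilt i \<tau> z) \<partial>base)"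
    by (rule nn_integral_shift[OF assms]) measurable
  also have "\<dots> = emeasure (density base (\<lambda>z. ennreal (tilt i \<tau> z))) A"
    by (subst emeasure_density) (auto simp: mult.commute)
  finally show "emeasure (distr base base (shift i \<tau>)) A = emeasure (density base (\<lambda>z. ennreal (tilt i \<tau> z))) A" .
qed simp

lemma nn_integral_tilt:
  assumes "i \<noteq> j"
  shows "(\<integral>\<^sup>+z. ennreal (tilt i \<tau> z) \<partial>base) = 1"
  using nn_integral_shift[OF assms, of "\<lambda>_. 1" \<tau>] prob_space.emeasure_space_1[OF prob_space_base] by simp

lemma nn_integral_flip:
  assumes i: "i \<noteq> j" and F[measurable]: "F \<in> borel_measurable base"
  shows "(\<integral>\<^sup>+z. F ((fst z)(i := - fst z i), snd z) \<partial>base) = (\<integral>\<^sup>+z. F z \<partial>base)"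
proof -
  interpret coord: product_prob_space coord by (rule product_prob_space_coord)
  interpret G: prob_space "gauss_law R" by (rule prob_space_gauss)
  note [measurable] = measurable_base_component
  have ci: "coord i = sign_law r" using i by (simp add: coord_def)
  have "(\<lambda>z. (fst z)(i := - fst z i)) \<in> measurable base (PiM UNIV (\<lambda>_. borel))"
    unfolding fun_upd_def by (rule measurable_PiM_single') (auto intro: measurable_base_component)
  then have "(\<lambda>z. ((fst z)(i := - fst z i), snd z)) \<in> measurable base (PiM UNIV (\<lambda>_. borel) \<Otimes>\<^sub>M borel)"
    by (rule measurable_Pair) measurable
  then have "(\<lambda>z. ((fst z)(i := - fst z i), snd z)) \<in> measurable base base"
    using measurable_cong_sets[OF refl sets_base] by blast
  then have flip: "(\<lambda>z. F ((fst z)(i := - fst z i), snd z)) \<in> borel_measurable base"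
    using F by (rule measurable_compose)
  have "(\<integral>\<^sup>+y. \<integral>\<^sup>+e. F (x(i := - y), e) \<partial>gauss_law R \<partial>sign_law r) =
      (\<integral>\<^sup>+y. \<integral>\<^sup>+e. F (x(i := y), e) \<partial>gauss_law R \<partial>sign_law r)"
    for x
  proof -
    define H where "H y = (\<integral>\<^sup>+e. F (x(i := y), e) \<partial>gauss_law R)" for y
    have "(\<lambda>p. (x(i := fst p), snd p)) \<in> measurable (borel \<Otimes>\<^sub>M gauss_law R) (PiM UNIV (\<lambda>_. borel) \<Otimes>\<^sub>M borel)"
    proof (rule measurable_Pair)
      show "(\<lambda>p. x(i := fst p)) \<in> measurable (borel \<Otimes>\<^sub>M gauss_law R) (PiM UNIV (\<lambda>_. borel))"
        unfolding fun_upd_def by (rule measurable_PiM_single') auto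
    qed simp
    moreover have "F \<in> borel_measurable (PiM UNIV (\<lambda>_. borel) \<Otimes>\<^sub>M borel)"
      using F measurable_cong_sets[OF sets_base refl] by blast
    ultimately have "(\<lambda>p. F (x(i := fst p), snd p)) \<in> borel_measurable (borel \<Otimes>\<^sub>M gauss_law R)"
      by (rule measurable_compose)
    from G.borel_measurable_nn_integral_fst[OF this]
    have H[measurable]: "H \<in> borel_measurable borel" unfolding H_def by simp
    have "(\<integral>\<^sup>+y. H (- y) \<partial>sign_law r) = (\<integral>\<^sup>+y. H y \<partial>sign_law r)"
      by (subst (1 2) nn_integral_sign_law) (simp_all add: add.commute)
    then show ?thesis unfolding H_def .
  qed
  then show ?thesis
    using nn_integral_base_split[OF flip, of i] nn_integral_base_split[OF F, of i] ci
    by simp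
qed

lemma AE_component_eq_sign:
  assumes i: "i \<noteq> j"
  shows "AE z in base. fst z i = r \<or> fst z i = - r"
proof -
  note [measurable] = measurable_base_component
  have ci: "coord i = sign_law r" using i by (simp add: coord_def)
  define F where "F = (\<lambda>z :: ('p \<Rightarrow> real) \<times> real. if fst z i = r \<or> fst z i = - r then 0 else 1 :: ennreal)"
  have F[measurable]: "F \<in> borel_measurable base" unfolding F_def by measurable
  have "(\<integral>\<^sup>+z. F z \<partial>base) = 0"
  proof -
    have "(\<integral>\<^sup>+y. \<integral>\<^sup>+e. F (x(i := y), e) \<partial>gauss_law R \<partial>sign_law r) = 0" for x
    proof -
      have "(\<integral>\<^sup>+y. \<integral>\<^sup>+e. F (x(i := y), e) \<partial>gauss_law R \<partial>sign_law r) =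
          (\<integral>\<^sup>+y. (if y = r \<or> y = - r then 0 else 1) \<partial>sign_law r)"
        by (simp add: F_def prob_space.emeasure_space_1[OF prob_space_gauss, simplified])
      also have "\<dots> = 0" by (subst nn_integral_sign_law) simp_all
      finally show ?thesis .
    qed
    then show ?thesis using nn_integral_base_split[OF F, of i] ci by simp
  qed
  then have "AE z in base. F z = 0" using F by (subst (asm) nn_integral_0_iff_AE) auto
  then show ?thesis by eventually_elim (simp add: F_def split: if_splits)
qed

text \<open>
  Since \<open>\<omega>\<^sub>i = r\<close> or \<open>\<omega>\<^sub>i = - r\<close>, averaging the tilts with \<open>\<theta>\<close> and \<open>- \<theta>\<close> gives a hyperbolic cosine that does not
  involve \<open>\<omega>\<^sub>i\<close> any more.
\<close>

lemma reference_eq: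
  assumes "i \<noteq> j"
  shows "reference = density base (\<lambda>z. ennreal ((tilt i \<theta> z + tilt i (- \<theta>) z) / 2))"
  unfolding reference_def
proof (rule density_cong)
  show "AE z in base. ennreal (cosh (\<theta> * r * score z) * exp (- (\<theta> * r)\<^sup>2 * info / 2)) =
      ennreal ((tilt i \<theta> z + tilt i (- \<theta>) z) / 2)"
    using AE_component_eq_sign[OF assms]
  proof eventually_elim
    case (elim z)
    have *: "cosh x * exp (- k / 2) = (exp (x - k / 2) + exp (- x - k / 2)) / 2" for x k :: real
      using exp_add[of x "- k / 2"] exp_add[of "- x" "- k / 2"]
      by (simp add: cosh_field_def algebra_simps add_divide_distrib)
    have "cosh (\<theta> * r * score z) * exp (- ((\<theta> * r)\<^sup>2 * info) / 2) = (tilt i \<theta> z + tilt i (- \<theta>) z) / 2"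
      unfolding * tilt_def using elim by (auto simp: power_mult_distrib add.commute)
    moreover have "- (\<theta> * r)\<^sup>2 * info / 2 = - ((\<theta> * r)\<^sup>2 * info) / 2" by simp
    ultimately show ?case by (simp only:)
  qed
  have [measurable]: "cosh \<in> borel_measurable (borel :: real measure)"
    by (intro borel_measurable_continuous_onI continuous_intros)
  show "(\<lambda>z. ennreal (cosh (\<theta> * r * score z) * exp (- (\<theta> * r)\<^sup>2 * info / 2))) \<in> borel_measurable base"
    "(\<lambda>z. ennreal ((tilt i \<theta> z + tilt i (- \<theta>) z) / 2)) \<in> borel_measurable base"
    by measurable
qed

lemma prob_space_reference:
  assumes "i \<noteq> j"
  shows "prob_space reference"
proof
  have "emeasure reference (space reference) =
      (\<integral>\<^sup>+z. ennreal (1/2) * (ennreal (tilt i \<theta> z) + ennreal (tilt i (- \<theta>) z)) \<partial>base)"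
    unfolding reference_eq[OF assms]
    by (subst emeasure_density)
      (auto intro!: nn_integral_cong simp: tilt_pos less_imp_le ennreal_half_add sets.top[of base, simplified])
  also have "\<dots> = ennreal (1/2) * (1 + 1)"
    by (simp add: nn_integral_cmult nn_integral_add nn_integral_tilt[OF assms])
  also have "\<dots> = ennreal (1/2) * ennreal 2" by simp
  also have "\<dots> = 1" by (subst ennreal_mult[symmetric]) simp_all
  finally show "emeasure reference (space reference) = 1" .
qed

text \<open>
  With \<open>q = (P + N) / 2\<close> one has \<open>P\<^sup>2 / q = 2 P - P N / q\<close>, and \<open>1 / q \<ge> 2 - q\<close>. The right-hand side is affine in
  \<open>P\<close> and \<open>N\<close> once their product is a constant, which is the case for opposite tilts.
\<close>

lemma tilt_chi2_pointwise:
  fixes P N :: real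
  assumes "P > 0" "N > 0"
  shows "P\<^sup>2 / ((P + N) / 2) + 2 * (P * N) \<le> 2 * P + P * N * ((P + N) / 2)"
proof -
  define q where "q = (P + N) / 2"
  have q: "q > 0" using assms by (simp add: q_def)
  have "P\<^sup>2 = q * (2 * P) - P * N" by (simp add: q_def power2_eq_square algebra_simps)
  then have "P\<^sup>2 / q = 2 * P - P * N / q" using q by (simp add: field_simps)
  moreover have "2 \<le> q + 1 / q"
  proof -
    have "0 \<le> (q - 1)\<^sup>2 / q" using q by simp
    also have "\<dots> = q + 1 / q - 2" using q by (simp add: field_simps power2_eq_square)
    finally show ?thesis by simp
  qed
  then have "P * N * 2 \<le> P * N * (q + 1 / q)" using assms by (intro mult_left_mono) auto
  ultimately show ?thesis unfolding q_def[symmetric] by (simp add: algebra_simps)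
qed

text \<open>
  Opposite tilts have constant product \<open>d = exp (- \<theta>\<^sup>2 r\<^sup>2 info)\<close> and integral \<open>1\<close>, so integrating
  \<open>tilt_chi2_pointwise\<close> gives the bound \<open>2 - d \<le> 1 / d\<close>.
\<close>

lemma nn_integral_tilt_chi2:
  assumes i: "i \<noteq> j"
  shows "(\<integral>\<^sup>+z. ennreal ((tilt i \<theta> z)\<^sup>2 / ((tilt i \<theta> z + tilt i (- \<theta>) z) / 2)) \<partial>base)
    \<le> ennreal (exp ((\<theta> * r)\<^sup>2 * info))"
proof -
  interpret prob_space base by (rule prob_space_base)
  define d where "d = exp (- ((\<theta> * r)\<^sup>2 * info))"
  define I where "I = (\<integral>\<^sup>+z. ennreal ((tilt i \<theta> z)\<^sup>2 / ((tilt i \<theta> z + tilt i (- \<theta>) z) / 2)) \<partial>base)"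
  have d: "d > 0" by (simp add: d_def)
  have "0 \<le> (\<theta> * r)\<^sup>2 * info" unfolding info_def by (intro mult_nonneg_nonneg add_nonneg_nonneg) simp_all
  then have d1: "d \<le> 1" by (simp add: d_def)
  have "I + ennreal (2 * d) = (\<integral>\<^sup>+z. ennreal ((tilt i \<theta> z)\<^sup>2 / ((tilt i \<theta> z + tilt i (- \<theta>) z) / 2)) + ennreal (2 * d) \<partial>base)"
    unfolding I_def by (subst nn_integral_add) (auto simp: emeasure_space_1[simplified])
  also have "\<dots> \<le> (\<integral>\<^sup>+z. ennreal (2 + d / 2) * ennreal (tilt i \<theta> z) + ennreal (d / 2) * ennreal (tilt i (- \<theta>) z) \<partial>base)"
  proof (rule nn_integral_mono_AE, use AE_component_eq_sign[OF i] in eventually_elim)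
    case (elim z)
    have eq: "tilt i \<theta> z * tilt i (- \<theta>) z = d"
      unfolding tilt_def d_def using elim by (auto simp: exp_add[symmetric] power_mult_distrib)
    have "(tilt i \<theta> z)\<^sup>2 / ((tilt i \<theta> z + tilt i (- \<theta>) z) / 2) + 2 * d
        \<le> (2 + d / 2) * tilt i \<theta> z + d / 2 * tilt i (- \<theta>) z"
      using tilt_chi2_pointwise[OF tilt_pos[of i \<theta> z] tilt_pos[of i "- \<theta>" z]] unfolding eq by (simp add: algebra_simps add_divide_distrib)
    then show ?case
      using tilt_pos[of i \<theta> z] tilt_pos[of i "- \<theta>" z] d
      by (simp add: ennreal_plus[symmetric] ennreal_mult[symmetric] less_imp_le del: ennreal_plus)
  qed
  also have "\<dots> = ennreal (2 + d / 2) + ennreal (d / 2)"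
    by (simp add: nn_integral_add nn_integral_cmult nn_integral_tilt[OF i] del: ennreal_plus)
  also have "\<dots> = ennreal (2 + d)" using d by (simp add: ennreal_plus[symmetric] del: ennreal_plus)
  also have "\<dots> = ennreal (2 - d) + ennreal (2 * d)"
    using d d1 by (subst ennreal_plus[symmetric]) auto
  finally have "I \<le> ennreal (2 - d)" by (simp add: ennreal_add_left_cancel_le add.commute[of _ "ennreal (2 * d)"])
  also have "2 - d \<le> exp ((\<theta> * r)\<^sup>2 * info)"
  proof -
    define x where "x = (\<theta> * r)\<^sup>2 * info"
    have "1 + x \<le> exp x" "1 + (- x) \<le> exp (- x)" by (rule exp_ge_add_one_self)+
    then show ?thesis unfolding d_def x_def[symmetric] by linarith
  qed
  finally show ?thesis unfolding I_def by (simp add: ennreal_leI)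
qed

lemma chi2_bounded_tilt:
  assumes "i \<noteq> j"
  shows "chi2_bounded (ennreal (exp ((\<theta> * r)\<^sup>2 * info))) (density base (\<lambda>z. ennreal (tilt i \<theta> z))) reference"
  unfolding reference_eq[OF assms]
  by (rule chi2_bounded_density[OF _ _ _ _ nn_integral_tilt_chi2[OF assms]])
    (auto simp: tilt_pos less_imp_le add_pos_pos)

lemma mech_response:
  assumes "j \<notin> S"
  shows "design S \<omega> \<bullet> beta (mech S) = b * \<omega> j"
proof -
  have "beta (mech S) \<bullet> design S \<omega> = (\<Sum>l\<in>UNIV. (if l = j then b * \<omega> l else 0))"
    unfolding inner_design using assms by (intro sum.cong) auto
  then show ?thesis by (simp add: inner_commute)
qed

lemma law_eq_distr: "law (mech S) = distr base (borel \<Otimes>\<^sub>M borel) (\<lambda>z. (design S (fst z), snd z))"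
proof -
  interpret G: prob_space "gauss_law R" by (rule prob_space_gauss)
  have "distr (gauss_law R) borel (\<lambda>x. x) = distr (gauss_law R) (gauss_law R) (\<lambda>x. x)"
    by (rule distr_cong) auto
  then have id: "distr (gauss_law R) borel (\<lambda>x. x) = gauss_law R"
    by (simp add: distr_id[unfolded id_def])
  have "distr latent borel (design S) \<Otimes>\<^sub>M distr (gauss_law R) borel (\<lambda>x. x) =
      distr (latent \<Otimes>\<^sub>M gauss_law R) (borel \<Otimes>\<^sub>M borel) (\<lambda>(x, y). (design S x, y))"
    by (rule pair_measure_distr) (auto simp: id G.sigma_finite_measure_axioms)
  then show ?thesis by (simp add: id base_def case_prod_unfold)
qed

lemma labelled_law_mech:
  assumes "j \<notin> S"
  shows "labelled_law (mech S) Ob = distr base (PiM Ob (\<lambda>_. borel) \<Otimes>\<^sub>M borel) (obs S Ob)"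
  unfolding labelled_law_def law_eq_distr
  by (subst distr_distr) (auto simp: comp_def obs_def[abs_def] mech_response[OF assms] simp del: mech_simps)

lemma unlabelled_law_mech: "unlabelled_law (mech S) = distr base borel (\<lambda>z. design S (fst z))"
  unfolding unlabelled_law_def law_eq_distr
  by (subst distr_distr) (auto simp: comp_def)

lemma design_insert:
  assumes "i \<notin> S" "j \<notin> S"
  shows "design (insert i S) (fst z) = design S (fst (shift i \<theta> z))"
proof -
  have "(\<Sum>l\<in>S. ((fst z)(j := fst z j + \<theta> * fst z i)) l) = (\<Sum>l\<in>S. fst z l)"
    using assms by (intro sum.cong) auto
  then show ?thesis using assms
    by (simp add: design_def shift_def vec_eq_iff algebra_simps)
qed

lemma obs_insert:
  assumes "i \<notin> S" "j \<notin> S"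
  shows "obs (insert i S) Ob z = obs S Ob (shift i \<theta> z)"
  unfolding obs_def design_insert[OF assms] by (simp add: shift_def algebra_simps)

lemma distr_base_shift:
  assumes "i \<noteq> j" and [measurable]: "G \<in> measurable base N"
  shows "distr base N (\<lambda>z. G (shift i \<theta> z)) = distr (density base (\<lambda>z. ennreal (tilt i \<theta> z))) N G"
  unfolding distr_shift[OF assms(1), symmetric] by (subst distr_distr) (auto simp: comp_def)

text \<open>
  If \<open>i\<close> is not observed, flipping the sign of \<open>\<omega>\<^sub>i\<close> leaves the observation unchanged and exchanges the two
  tilts. If \<open>j\<close> is not observed, the observation is unchanged by both shifts.
\<close>

lemma nn_integral_obs_tilt_neg:
  assumes ij: "i \<noteq> j" and S: "i \<notin> S" "j \<notin> S" and unobserved: "i \<notin> Ob \<or> j \<notin> Ob"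
    and [measurable]: "h \<in> borel_measurable (PiM Ob (\<lambda>_. borel) \<Otimes>\<^sub>M borel)"
  shows "(\<integral>\<^sup>+z. h (obs S Ob z) * ennreal (tilt i (- \<theta>) z) \<partial>base) = (\<integral>\<^sup>+z. h (obs S Ob z) * ennreal (tilt i \<theta> z) \<partial>base)"
proof (cases "j \<in> Ob")
  case False
  have "obs S Ob (shift i \<tau> z) = obs S Ob z" for \<tau> z
    unfolding obs_def shift_def using False by (auto simp: design_def algebra_simps restrict_def fun_eq_iff)
  then show ?thesis
    by (subst (1 2) nn_integral_shift[OF ij, symmetric]) simp_all
next
  case True
  then have i: "i \<notin> Ob" using unobserved by simp
  define flip where "flip z = ((fst z)(i := - fst z i), snd z)" for z :: "('p \<Rightarrow> real) \<times> real"
  have "(\<Sum>l\<in>S. fst (flip z) l) = (\<Sum>l\<in>S. fst z l)" for z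
    using S by (intro sum.cong) (auto simp: flip_def)
  then have o: "obs S Ob (flip z) = obs S Ob z" for z
    unfolding obs_def using i ij by (auto simp: design_def restrict_def fun_eq_iff flip_def)
  have t: "tilt i \<theta> (flip z) = tilt i (- \<theta>) z" for z
    using ij by (simp add: tilt_def score_def flip_def)
  show ?thesis
    using nn_integral_flip[OF ij, of "\<lambda>z. h (obs S Ob z) * ennreal (tilt i \<theta> z)"]
    unfolding flip_def[symmetric] o t by simp
qed

text \<open>
  An observation that misses \<open>i\<close> or \<open>j\<close> cannot tell the index \<open>i\<close> from an independent sign. This is the point
  where the missingness pattern enters.
\<close>

lemma distr_reference_unobserved:
  assumes ij: "i \<noteq> j" and S: "i \<notin> S" "j \<notin> S" and unobserved: "i \<notin> Ob \<or> j \<notin> Ob"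
  shows "distr reference (PiM Ob (\<lambda>_. borel) \<Otimes>\<^sub>M borel) (obs S Ob) =
    distr (density base (\<lambda>z. ennreal (tilt i \<theta> z))) (PiM Ob (\<lambda>_. borel) \<Otimes>\<^sub>M borel) (obs S Ob)"
    (is "?Q = ?P")
proof (rule measure_eqI)
  let ?N = "PiM Ob (\<lambda>_. borel) \<Otimes>\<^sub>M borel :: (('p \<Rightarrow> real) \<times> real) measure"
  fix A assume "A \<in> sets ?Q"
  then have A[measurable]: "A \<in> sets ?N" by simp
  let ?h = "\<lambda>z. indicator A (obs S Ob z) :: ennreal"
  have P: "emeasure (distr (density base w) ?N (obs S Ob)) A = (\<integral>\<^sup>+z. ?h z * w z \<partial>base)"
    if [measurable]: "w \<in> borel_measurable base" for w
  proof -
    have "emeasure (distr (density base w) ?N (obs S Ob)) A = (\<integral>\<^sup>+z. indicator A z \<partial>distr (density base w) ?N (obs S Ob))"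
      by simp
    also have "\<dots> = (\<integral>\<^sup>+z. ?h z \<partial>density base w)"
      by (rule nn_integral_distr) measurable
    also have "\<dots> = (\<integral>\<^sup>+z. ?h z * w z \<partial>base)"
      by (subst nn_integral_density) (simp_all add: mult.commute)
    finally show ?thesis .
  qed
  have "emeasure ?Q A = (\<integral>\<^sup>+z. ?h z * ennreal ((tilt i \<theta> z + tilt i (- \<theta>) z) / 2) \<partial>base)"
    unfolding reference_eq[OF ij] by (rule P) measurable
  also have "\<dots> = (\<integral>\<^sup>+z. ennreal (1/2) * (?h z * ennreal (tilt i \<theta> z) + ?h z * ennreal (tilt i (- \<theta>) z)) \<partial>base)"
    by (intro nn_integral_cong) (subst ennreal_half_add, auto simp: tilt_pos less_imp_le distrib_left mult_ac)
  also have "\<dots> = ennreal (1/2) * ((\<integral>\<^sup>+z. ?h z * ennreal (tilt i \<theta> z) \<partial>base) + (\<integral>\<^sup>+z. ?h z * ennreal (tilt i (- \<theta>) z) \<partial>base))"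
    by (subst nn_integral_cmult, measurable, subst nn_integral_add, measurable)
  also have "(\<integral>\<^sup>+z. ?h z * ennreal (tilt i (- \<theta>) z) \<partial>base) = (\<integral>\<^sup>+z. ?h z * ennreal (tilt i \<theta> z) \<partial>base)"
    by (rule nn_integral_obs_tilt_neg[OF assms]) measurable
  also have "ennreal (1/2) * ((\<integral>\<^sup>+z. ?h z * ennreal (tilt i \<theta> z) \<partial>base) + (\<integral>\<^sup>+z. ?h z * ennreal (tilt i \<theta> z) \<partial>base))
      = (ennreal (1/2) * 2) * (\<integral>\<^sup>+z. ?h z * ennreal (tilt i \<theta> z) \<partial>base)"
    by (simp add: mult_2[symmetric] mult_ac)
  also have "ennreal (1/2) * 2 = 1"
    using ennreal_mult[of "1/2" 2] by simp
  also have "1 * (\<integral>\<^sup>+z. ?h z * ennreal (tilt i \<theta> z) \<partial>base) = emeasure ?P A"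
    by (subst P) simp_all
  finally show "emeasure ?Q A = emeasure ?P A" .
qed simp

text \<open>
  The logarithm of the factor by which one informative observation can increase the second moment of the
  likelihood ratio.
\<close>

definition chi2_cost :: real where
  "chi2_cost = (\<theta> * r)\<^sup>2 * info"

lemma chi2_bounded_labelled_law:
  assumes ij: "i \<noteq> j" and S: "i \<notin> S" "j \<notin> S"
  shows "chi2_bounded (ennreal (exp (chi2_cost * of_bool (i \<in> Ob \<and> j \<in> Ob)))) (labelled_law (mech (insert i S)) Ob)
    (distr reference (PiM Ob (\<lambda>_. borel) \<Otimes>\<^sub>M borel) (obs S Ob))"
proof -
  let ?N = "PiM Ob (\<lambda>_. borel) \<Otimes>\<^sub>M borel :: (('p \<Rightarrow> real) \<times> real) measure"
  have "obs (insert i S) Ob = (\<lambda>z. obs S Ob (shift i \<theta> z))"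
    by (rule ext) (rule obs_insert[OF S])
  then have P: "labelled_law (mech (insert i S)) Ob = distr (density base (\<lambda>z. ennreal (tilt i \<theta> z))) ?N (obs S Ob)"
    using ij S by (subst labelled_law_mech) (simp_all add: distr_base_shift)
  show ?thesis
  proof (cases "i \<in> Ob \<and> j \<in> Ob")
    case True
    have "chi2_bounded (ennreal (exp chi2_cost)) (distr (density base (\<lambda>z. ennreal (tilt i \<theta> z))) ?N (obs S Ob))
        (distr reference ?N (obs S Ob))"
      unfolding chi2_cost_def
      by (rule chi2_bounded_distr[OF chi2_bounded_tilt[OF ij]]) (simp add: reference_def)
    then show ?thesis using True P by simp
  next
    case False
    then have "distr reference ?N (obs S Ob) = labelled_law (mech (insert i S)) Ob"
      unfolding P using distr_reference_unobserved[OF ij S] by blast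
    moreover have "prob_space (labelled_law (mech (insert i S)) Ob)"
      using ij S by (subst labelled_law_mech) (auto intro: prob_space.prob_space_distr[OF prob_space_base])
    ultimately show ?thesis using False chi2_bounded_refl by auto
  qed
qed

lemma chi2_bounded_unlabelled_law:
  assumes ij: "i \<noteq> j" and S: "i \<notin> S" "j \<notin> S"
  shows "chi2_bounded (ennreal (exp chi2_cost)) (unlabelled_law (mech (insert i S)))
    (distr reference borel (\<lambda>z. design S (fst z)))"
proof -
  have "unlabelled_law (mech (insert i S)) = distr (density base (\<lambda>z. ennreal (tilt i \<theta> z))) borel (\<lambda>z. design S (fst z))"
    unfolding unlabelled_law_mech
    using distr_base_shift[OF ij, of "\<lambda>z. design S (fst z)" borel] design_insert[OF S] by simp
  then show ?thesis
    unfolding chi2_cost_def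
    using chi2_bounded_distr[OF chi2_bounded_tilt[OF ij], of "\<lambda>z. design S (fst z)" borel]
    by (simp add: reference_def)
qed

end

section \<open>Testing the index of one block\<close>

context spiked_design
begin

declare mech_simps [simp del]

definition reference_data ::
  "nat \<Rightarrow> (nat \<Rightarrow> 'p set) \<Rightarrow> (nat \<Rightarrow> nat) \<Rightarrow> nat \<Rightarrow> 'p set \<Rightarrow> 'p data measure" where
  "reference_data K Obs n N S =
     (\<Pi>\<^sub>M k\<in>{..<K}. \<Pi>\<^sub>M i\<in>{..<n k}. distr reference ((\<Pi>\<^sub>M l\<in>Obs k. borel) \<Otimes>\<^sub>M borel) (obs S (Obs k)))
     \<Otimes>\<^sub>M (\<Pi>\<^sub>M i\<in>{..<N}. distr reference borel (\<lambda>z. design S (fst z)))"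

lemma sets_reference [measurable_cong]: "sets reference = sets base"
  by (simp add: reference_def)

lemma prob_space_labelled_law: "j \<notin> S \<Longrightarrow> prob_space (labelled_law (mech S) Ob)"
  by (subst labelled_law_mech) (auto intro: prob_space.prob_space_distr[OF prob_space_base])

lemma prob_space_unlabelled_law: "prob_space (unlabelled_law (mech S))"
  unfolding unlabelled_law_mech by (rule prob_space.prob_space_distr[OF prob_space_base]) measurable

lemma prob_space_data_law: "j \<notin> S \<Longrightarrow> prob_space (data_law K Obs n N (mech S))"
  unfolding data_law_def
  by (intro prob_space_pair prob_space_PiM prob_space_labelled_law prob_space_unlabelled_law)

lemma
  assumes ij: "i \<noteq> j"
  shows prob_space_reference_labelled:
      "prob_space (distr reference ((\<Pi>\<^sub>M l\<in>Ob. borel) \<Otimes>\<^sub>M borel) (obs S Ob))"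
    and prob_space_reference_unlabelled:
      "prob_space (distr reference borel (\<lambda>z. design S (fst z)))"
  by (rule prob_space.prob_space_distr[OF prob_space_reference[OF ij]], measurable)+

lemma prob_space_reference_data: "i \<noteq> j \<Longrightarrow> prob_space (reference_data K Obs n N S)"
  unfolding reference_data_def
  by (intro prob_space_pair prob_space_PiM prob_space_reference_labelled prob_space_reference_unlabelled)

lemma sets_reference_data: "sets (reference_data K Obs n N S) = sets (data_space K Obs n N)"
  unfolding reference_data_def data_space_def
  by (intro sets_pair_measure_cong sets_PiM_cong) simp_all

lemma chi2_bounded_data_law:
  assumes ij: "i \<noteq> j" and S: "i \<notin> S" "j \<notin> S"
  shows "chi2_bounded (ennreal (exp (chi2_cost *
      ((\<Sum>k<K. real (n k) * of_bool (i \<in> Obs k \<and> j \<in> Obs k)) + real N))))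
    (data_law K Obs n N (mech (insert i S))) (reference_data K Obs n N S)"
proof -
  let ?c = "\<lambda>k. chi2_cost * of_bool (i \<in> Obs k \<and> j \<in> Obs k)"
  let ?L = "labelled_law (mech (insert i S))"
  let ?R = "\<lambda>Ob. distr reference ((\<Pi>\<^sub>M l\<in>Ob. borel) \<Otimes>\<^sub>M borel) (obs S Ob)"
  have jS: "j \<notin> insert i S" using ij S by auto
  note prob = prob_space_labelled_law[OF jS] prob_space_unlabelled_law
    prob_space_reference_labelled[OF ij] prob_space_reference_unlabelled[OF ij]
  have "chi2_bounded (\<Prod>k<K. \<Prod>t<n k. ennreal (exp (?c k)))
      (\<Pi>\<^sub>M k\<in>{..<K}. \<Pi>\<^sub>M t\<in>{..<n k}. ?L (Obs k)) (\<Pi>\<^sub>M k\<in>{..<K}. \<Pi>\<^sub>M t\<in>{..<n k}. ?R (Obs k))"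
    by (intro chi2_bounded_PiM chi2_bounded_labelled_law[OF ij S] prob_space_PiM prob) auto
  moreover have "chi2_bounded (\<Prod>t<N. ennreal (exp chi2_cost))
      (\<Pi>\<^sub>M t\<in>{..<N}. unlabelled_law (mech (insert i S)))
      (\<Pi>\<^sub>M t\<in>{..<N}. distr reference borel (\<lambda>z. design S (fst z)))"
    by (intro chi2_bounded_PiM chi2_bounded_unlabelled_law[OF ij S] prob) auto
  ultimately have "chi2_bounded ((\<Prod>k<K. \<Prod>t<n k. ennreal (exp (?c k))) * (\<Prod>t<N. ennreal (exp chi2_cost)))
    (data_law K Obs n N (mech (insert i S))) (reference_data K Obs n N S)"
    unfolding data_law_def reference_data_def
    by (rule chi2_bounded_pair)
      (intro prob_space_imp_sigma_finite prob_space_PiM prob)+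
  moreover have "(\<Prod>k<K. \<Prod>t<n k. ennreal (exp (?c k))) * (\<Prod>t<N. ennreal (exp chi2_cost)) =
      ennreal ((\<Prod>k<K. exp (?c k) ^ n k) * exp chi2_cost ^ N)"
    by (simp add: ennreal_power prod_ennreal ennreal_mult prod_nonneg)
  moreover have "(\<Prod>k<K. exp (?c k) ^ n k) * exp chi2_cost ^ N =
      exp (chi2_cost * ((\<Sum>k<K. real (n k) * of_bool (i \<in> Obs k \<and> j \<in> Obs k)) + real N))"
    by (simp add: exp_of_nat_mult[symmetric] exp_sum[symmetric] exp_add[symmetric] distrib_left
        sum_distrib_left mult_ac del: sum_mult_of_bool_eq sum_of_bool_mult_eq)
  ultimately show ?thesis by simp
qed

text \<open>
  The data law has second moment at most \<open>exp (chi2_cost T) \<le> sqrt M\<close>, so the sum is at most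
  \<open>sqrt (M sqrt M)\<close>, which is at most \<open>M / 2\<close> as soon as \<open>M \<ge> 16\<close>.
\<close>

lemma sum_prob_data_law_le:
  fixes g :: "nat \<Rightarrow> 'p"
  assumes "j \<notin> S" and g: "\<And>i. i < M \<Longrightarrow> g i \<noteq> j \<and> g i \<notin> S"
    and count: "\<And>i. i \<noteq> j \<Longrightarrow>
      (\<Sum>k<K. real (n k) * of_bool (i \<in> Obs k \<and> j \<in> Obs k)) + real N \<le> T"
    and cost: "chi2_cost * T \<le> ln (real M) / 2" and M: "M \<ge> 16"
    and A: "\<And>i. i < M \<Longrightarrow> A i \<in> sets (data_space K Obs n N)"
    and disj: "disjoint_family_on A {..<M}"
  shows "(\<Sum>i<M. measure (data_law K Obs n N (mech (insert (g i) S))) (A i)) \<le> real M / 2"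
proof -
  have g0: "g 0 \<noteq> j" using g[of 0] M by simp
  have cost0: "chi2_cost \<ge> 0" by (simp add: chi2_cost_def info_def)
  have "(\<Sum>i<M. measure (data_law K Obs n N (mech (insert (g i) S))) (A i)) \<le> sqrt (real (card {..<M}) * sqrt (real M))"
  proof (rule sum_measure_disjoint_le_of_chi2_bounded[where Q = "reference_data K Obs n N S"])
    show "prob_space (reference_data K Obs n N S)" by (rule prob_space_reference_data[OF g0])
    fix i assume "i \<in> {..<M}"
    then have i: "g i \<noteq> j" "g i \<notin> S" "i < M" using g by auto
    show "prob_space (data_law K Obs n N (mech (insert (g i) S)))"
      using i \<open>j \<notin> S\<close> by (intro prob_space_data_law) auto
    show "A i \<in> sets (reference_data K Obs n N S)" using A[OF i(3)] by (simp add: sets_reference_data)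
    have "exp (chi2_cost * ((\<Sum>k<K. real (n k) * of_bool (g i \<in> Obs k \<and> j \<in> Obs k)) + real N)) \<le> exp (ln (real M) / 2)"
      using mult_left_mono[OF count[OF i(1)] cost0] cost by simp
    also have "\<dots> = sqrt (real M)"
      using M by (simp add: powr_half_sqrt[symmetric] powr_def)
    finally show "chi2_bounded (ennreal (sqrt (real M))) (data_law K Obs n N (mech (insert (g i) S))) (reference_data K Obs n N S)"
      by (intro chi2_bounded_mono[OF chi2_bounded_data_law[OF i(1,2) \<open>j \<notin> S\<close>]] ennreal_leI)
  qed (use disj in auto)
  also have "\<dots> \<le> real M / 2"
  proof (rule real_le_lsqrt)
    have "4 \<le> sqrt (real M)" using M by (intro real_le_rsqrt) simp
    then have "4 * sqrt (real M) \<le> sqrt (real M) * sqrt (real M)" by (intro mult_right_mono) auto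
    then have "4 * sqrt (real M) \<le> real M" by simp
    then have "real M * (4 * sqrt (real M)) \<le> real M * real M" by (intro mult_left_mono) auto
    then show "real (card {..<M}) * sqrt (real M) \<le> (real M / 2)\<^sup>2" by (simp add: power2_eq_square)
  qed simp_all
  finally show ?thesis .
qed

end

section \<open>From testing to squared error\<close>

lemma sum_PiE_remove:
  assumes "finite I" "b \<in> I"
  shows "(\<Sum>v\<in>PiE I (\<lambda>_. T). f v) = (\<Sum>w\<in>PiE (I - {b}) (\<lambda>_. T). \<Sum>i\<in>T. f (w(b := i)))"
proof -
  let ?up = "\<lambda>(i, w). w(b := i)"
  have "PiE I (\<lambda>_. T) = ?up ` (T \<times> PiE (I - {b}) (\<lambda>_. T))"
    using PiE_insert_eq[of b "I - {b}" "\<lambda>_. T"] assms by (simp add: insert_absorb)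
  moreover have "inj_on ?up (T \<times> PiE (I - {b}) (\<lambda>_. T))"
    using inj_combinator[of b "I - {b}" "\<lambda>_. T"] by simp
  ultimately have "(\<Sum>v\<in>PiE I (\<lambda>_. T). f v) = (\<Sum>p\<in>T \<times> PiE (I - {b}) (\<lambda>_. T). f (?up p))"
    by (simp add: sum.reindex comp_def)
  also have "\<dots> = (\<Sum>i\<in>T. \<Sum>w\<in>PiE (I - {b}) (\<lambda>_. T). f (w(b := i)))"
    by (simp add: sum.cartesian_product case_prod_unfold)
  also have "\<dots> = (\<Sum>w\<in>PiE (I - {b}) (\<lambda>_. T). \<Sum>i\<in>T. f (w(b := i)))"
    by (rule sum.swap)
  finally show ?thesis .
qed

context spiked_design
begin

lemma norm_diff_beta:
  assumes "j \<notin> S"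
  shows "(norm (y - beta (mech S)))\<^sup>2 =
    y \<bullet> y - 2 * (b * y $ j - b * \<theta> * (\<Sum>l\<in>S. y $ l)) + (b\<^sup>2 + (b * \<theta>)\<^sup>2 * real (card S))"
proof -
  have "(norm (y - beta (mech S)))\<^sup>2 = y \<bullet> y - 2 * (y \<bullet> beta (mech S)) + beta (mech S) \<bullet> beta (mech S)"
    by (simp add: power2_norm_eq_inner inner_diff_left inner_diff_right inner_commute)
  then show ?thesis unfolding inner_beta_beta[OF assms] inner_beta[OF assms, of y] .
qed

text \<open>
  An estimator is only known to have measurable distances to the regression parameters of the class, so its
  coordinates need not be measurable. Squared distances to two parameters that differ in one block
  recover the difference of two coordinates by polarisation.
\<close>

lemma measurable_coordinate_difference:
  assumes meas: "(\<lambda>x. norm (bh x - beta (mech (insert i S)))) \<in> borel_measurable D"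
    "(\<lambda>x. norm (bh x - beta (mech (insert i' S)))) \<in> borel_measurable D"
    and S: "j \<notin> insert i S" "j \<notin> insert i' S" "i \<notin> S" "i' \<notin> S" and c: "b * \<theta> > 0"
  shows "(\<lambda>x. bh x $ i - bh x $ i') \<in> borel_measurable D"
proof -
  have "2 * (b * \<theta>) * (bh x $ i - bh x $ i') =
      (norm (bh x - beta (mech (insert i S))))\<^sup>2 - (norm (bh x - beta (mech (insert i' S))))\<^sup>2" for x
    using S unfolding norm_diff_beta[OF S(1)] norm_diff_beta[OF S(2)]
    by (simp add: algebra_simps)
  then have "bh x $ i - bh x $ i' = ((norm (bh x - beta (mech (insert i S))))\<^sup>2 -
      (norm (bh x - beta (mech (insert i' S))))\<^sup>2) / (2 * (b * \<theta>))" for x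
    using c by (metis mult_pos_pos nonzero_mult_div_cancel_left order_less_irrefl zero_less_numeral)
  then show ?thesis using meas by simp
qed

text \<open>
  The event that the estimate points to the \<open>i\<close>-th index \<open>g i\<close> of a block. The entry of the
  parameter at the selected index is negative and the others in the block are \<open>0\<close>, hence the minimum. Comparing coordinates,
  rather than distances to the candidates, only needs the differences that are known to be measurable.
\<close>

definition strict_argmin :: "('d \<Rightarrow> real^'p) \<Rightarrow> (nat \<Rightarrow> 'p) \<Rightarrow> nat \<Rightarrow> nat \<Rightarrow> 'd set" where
  "strict_argmin bh g M i = {x. \<forall>i'<M. i' \<noteq> i \<longrightarrow> bh x $ g i < bh x $ g i'}"

lemma disjoint_strict_argmin: "disjoint_family_on (\<lambda>i. strict_argmin bh g M i \<inter> D) {..<M}"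
  unfolding disjoint_family_on_def strict_argmin_def by fastforce

text \<open>
  If some index of the block beats the selected one, then the errors \<open>s + c\<close> and \<open>t\<close> at these two indices satisfy
  \<open>(s + c)\<^sup>2 + t\<^sup>2 \<ge> (s + c - t)\<^sup>2 / 2 \<ge> c\<^sup>2 / 2\<close>, where \<open>t \<le> s\<close> are the two entries of the estimate.
\<close>

lemma squared_error_ge:
  fixes idx :: "nat \<Rightarrow> nat \<Rightarrow> 'p"
  assumes inj: "inj_on (\<lambda>(k, i). idx k i) ({..<m} \<times> {..<M})"
    and ne: "\<And>k i. k < m \<Longrightarrow> i < M \<Longrightarrow> idx k i \<noteq> j"
    and v: "\<And>k. k < m \<Longrightarrow> v k < M" and c: "b * \<theta> > 0"
  shows "(b * \<theta>)\<^sup>2 / 2 * (\<Sum>k<m. of_bool (x \<notin> strict_argmin bh (idx k) M (v k))) \<le>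
    (norm (bh x - beta (mech ((\<lambda>k. idx k (v k)) ` {..<m}))))\<^sup>2"
proof -
  define c where "c = b * \<theta>"
  define \<beta> where "\<beta> = beta (mech ((\<lambda>k. idx k (v k)) ` {..<m}))"
  define y where "y = bh x"
  have \<beta>: "\<beta> $ idx k i = (if i = v k then - c else 0)" if "k < m" "i < M" for k i
  proof -
    have "idx k i \<in> (\<lambda>k. idx k (v k)) ` {..<m} \<longleftrightarrow> i = v k"
    proof
      assume "idx k i \<in> (\<lambda>k. idx k (v k)) ` {..<m}"
      then obtain k' where k': "k' < m" "idx k i = idx k' (v k')" by auto
      then have "(k, i) = (k', v k')"
        using that v by (intro inj_onD[OF inj]) auto
      then show "i = v k" by simp
    qed (use that in auto)
    then show ?thesis using ne[OF that] by (simp add: \<beta>_def mech_simps c_def)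
  qed
  have block: "c\<^sup>2 / 2 * of_bool (x \<notin> strict_argmin bh (idx k) M (v k)) \<le> (\<Sum>i<M. (y $ idx k i - \<beta> $ idx k i)\<^sup>2)"
    if k: "k < m" for k
  proof (cases "x \<in> strict_argmin bh (idx k) M (v k)")
    case True
    then show ?thesis by (simp add: sum_nonneg)
  next
    case False
    then obtain i' where i': "i' < M" "i' \<noteq> v k" "y $ idx k i' \<le> y $ idx k (v k)"
      unfolding strict_argmin_def y_def by auto
    define s t where "s = y $ idx k (v k)" and "t = y $ idx k i'"
    have "c\<^sup>2 \<le> (s - t + c)\<^sup>2"
      using i'(3) c by (intro power_mono) (auto simp: s_def t_def c_def)
    also have "\<dots> \<le> 2 * ((s + c)\<^sup>2 + t\<^sup>2)"
      using zero_le_power2[of "s + c + t"] by (simp add: power2_eq_square algebra_simps)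
    finally have "c\<^sup>2 / 2 \<le> (s + c)\<^sup>2 + t\<^sup>2" by simp
    also have "\<dots> = (\<Sum>i\<in>{v k, i'}. (y $ idx k i - \<beta> $ idx k i)\<^sup>2)"
      using i' v[OF k] k by (simp add: \<beta> s_def t_def)
    also have "\<dots> \<le> (\<Sum>i<M. (y $ idx k i - \<beta> $ idx k i)\<^sup>2)"
      using i' v[OF k] by (intro sum_mono2) auto
    finally show ?thesis using False by simp
  qed
  have "c\<^sup>2 / 2 * (\<Sum>k<m. of_bool (x \<notin> strict_argmin bh (idx k) M (v k))) \<le>
      (\<Sum>k<m. \<Sum>i<M. (y $ idx k i - \<beta> $ idx k i)\<^sup>2)"
    unfolding sum_distrib_left by (intro sum_mono block) simp
  also have "\<dots> = (\<Sum>p\<in>{..<m} \<times> {..<M}. (y $ (case p of (k, i) \<Rightarrow> idx k i) - \<beta> $ (case p of (k, i) \<Rightarrow> idx k i))\<^sup>2)"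
    by (simp add: sum.cartesian_product case_prod_unfold)
  also have "\<dots> = (\<Sum>l\<in>(\<lambda>(k, i). idx k i) ` ({..<m} \<times> {..<M}). (y $ l - \<beta> $ l)\<^sup>2)"
    by (simp add: sum.reindex[OF inj] comp_def)
  also have "\<dots> \<le> (\<Sum>l\<in>UNIV. (y $ l - \<beta> $ l)\<^sup>2)"
    by (rule sum_mono2) auto
  also have "\<dots> = (norm (y - \<beta>))\<^sup>2"
    by (simp only: power2_norm_eq_inner) (simp add: inner_vec_def power2_eq_square)
  finally show ?thesis by (simp add: c_def y_def \<beta>_def)
qed

text \<open>
  Average over all selections \<open>v\<close> of one index per block. For each block, the average can be taken over the
  remaining blocks first and over the index of this block last, where \<open>sum_prob_data_law_le\<close>
  applies. So on average at least half of the blocks are not recognised, and some selection does not do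
  better than the average.
\<close>

lemma exists_mech_with_large_risk:
  fixes idx :: "nat \<Rightarrow> nat \<Rightarrow> 'p"
  assumes inj: "inj_on (\<lambda>(k, i). idx k i) ({..<m} \<times> {..<M})"
    and ne: "\<And>k i. k < m \<Longrightarrow> i < M \<Longrightarrow> idx k i \<noteq> j"
    and c: "b * \<theta> > 0" and M: "M \<ge> 16"
    and count: "\<And>i. i \<noteq> j \<Longrightarrow>
      (\<Sum>k<K. real (n k) * of_bool (i \<in> Obs k \<and> j \<in> Obs k)) + real N \<le> T"
    and cost: "chi2_cost * T \<le> ln (real M) / 2"
    and meas: "\<And>v. v \<in> PiE {..<m} (\<lambda>_. {..<M}) \<Longrightarrow>
      (\<lambda>x. norm (bh x - beta (mech ((\<lambda>k. idx k (v k)) ` {..<m})))) \<in> borel_measurable (data_space K Obs n N)"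
  shows "\<exists>v\<in>PiE {..<m} (\<lambda>_. {..<M}).
    risk K Obs n N bh (mech ((\<lambda>k. idx k (v k)) ` {..<m})) \<ge> ennreal ((b * \<theta>)\<^sup>2 * real m / 4)"
proof -
  let ?D = "data_space K Obs n N"
  define V where "V = PiE {..<m} (\<lambda>_. {..<M})"
  define S where "S = (\<lambda>v. (\<lambda>k. idx k (v k)) ` {..<m})"
  define A where "A = (\<lambda>k i. strict_argmin bh (idx k) M i \<inter> space ?D)"
  define \<mu> where "\<mu> = (\<lambda>v. data_law K Obs n N (mech (S v)))"
  have vM: "v k < M" if "v \<in> V" "k < m" for v k using that by (auto simp: V_def PiE_def)
  have jS: "j \<notin> S v" if "v \<in> V" for v
    using ne vM[OF that] by (auto simp: S_def)
  have "finite V" unfolding V_def by (intro finite_PiE) auto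
  have "card V = M ^ m" unfolding V_def by (subst card_PiE) auto
  have prob: "prob_space (\<mu> v)" if "v \<in> V" for v
    unfolding \<mu>_def by (rule prob_space_data_law[OF jS[OF that]])
  have sets_\<mu>: "sets (\<mu> v) = sets ?D" for v unfolding \<mu>_def by (rule sets_data_law)
  have space_\<mu>: "space (\<mu> v) = space ?D" for v using sets_eq_imp_space_eq[OF sets_\<mu>] .

  \<comment> \<open>The part of the support outside block \<open>k\<close>; all \<open>M\<close> hypotheses of that block share it.\<close>
  define S' where "S' = (\<lambda>k w. (\<lambda>l. idx l (w l)) ` ({..<m} - {k}))"
  have upd: "w(k := i) \<in> V" "S (w(k := i)) = insert (idx k i) (S' k w)" "idx k i \<notin> S' k w"
    if w: "w \<in> PiE ({..<m} - {k}) (\<lambda>_. {..<M})" and k: "k < m" and i: "i < M" for k w i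
  proof -
    show "w(k := i) \<in> V" using w k i by (auto simp: V_def PiE_def extensional_def Pi_def)
    have "{..<m} = insert k ({..<m} - {k})" using k by auto
    then have "S (w(k := i)) = (\<lambda>l. idx l ((w(k := i)) l)) ` insert k ({..<m} - {k})"
      unfolding S_def by simp
    also have "\<dots> = insert (idx k i) (S' k w)" unfolding S'_def by (auto intro!: image_cong)
    finally show "S (w(k := i)) = insert (idx k i) (S' k w)" .
    show "idx k i \<notin> S' k w"
    proof
      assume "idx k i \<in> S' k w"
      then obtain l where l: "l < m" "l \<noteq> k" "idx k i = idx l (w l)" by (auto simp: S'_def)
      moreover have "w l < M" using w l by (auto simp: PiE_def)
      ultimately have "(k, i) = (l, w l)"
        using k i by (intro inj_onD[OF inj]) auto
      then show False using l by simp
    qed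
  qed

  have A[measurable]: "A k i \<in> sets ?D" if k: "k < m" and i: "i < M" for k i
  proof -
    \<comment> \<open>Any choice in the other blocks serves: it cancels in the polarisation.\<close>
    define w where "w = (\<lambda>l\<in>{..<m} - {k}. 0 :: nat)"
    have w: "w \<in> PiE ({..<m} - {k}) (\<lambda>_. {..<M})" using M by (auto simp: w_def)
    have "(\<lambda>x. bh x $ idx k i - bh x $ idx k i') \<in> borel_measurable ?D" if "i' < M" for i'
    proof (rule measurable_coordinate_difference[OF _ _ _ _ upd(3)[OF w k i] upd(3)[OF w k that] c])
      show "(\<lambda>x. norm (bh x - beta (mech (insert (idx k i) (S' k w))))) \<in> borel_measurable ?D"
        using meas[of "w(k := i)"] upd(1,2)[OF w k i] by (simp add: V_def S_def)
      show "(\<lambda>x. norm (bh x - beta (mech (insert (idx k i') (S' k w))))) \<in> borel_measurable ?D"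
        using meas[of "w(k := i')"] upd(1,2)[OF w k that] by (simp add: V_def S_def)
      show "j \<notin> insert (idx k i) (S' k w)" "j \<notin> insert (idx k i') (S' k w)"
        using jS[OF upd(1)[OF w k i]] jS[OF upd(1)[OF w k that]] upd(2)[OF w k i] upd(2)[OF w k that] by simp_all
    qed
    then have less: "{x\<in>space ?D. bh x $ idx k i < bh x $ idx k i'} \<in> sets ?D" if "i' < M" for i'
    proof -
      note [measurable] = \<open>\<And>i'. i' < M \<Longrightarrow> (\<lambda>x. bh x $ idx k i - bh x $ idx k i') \<in> borel_measurable ?D\<close>[OF that]
      have "{x\<in>space ?D. bh x $ idx k i - bh x $ idx k i' < 0} \<in> sets ?D" by measurable
      then show ?thesis by simp
    qed
    have "(if i = 0 then 1 else 0) \<in> {..<M} - {i}" using M by auto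
    then have "{..<M} - {i} \<noteq> {}" by blast
    have "A k i = (\<Inter>i'\<in>{..<M} - {i}. {x\<in>space ?D. bh x $ idx k i < bh x $ idx k i'})"
      using \<open>{..<M} - {i} \<noteq> {}\<close> unfolding A_def strict_argmin_def by auto
    also have "\<dots> \<in> sets ?D"
      using \<open>{..<M} - {i} \<noteq> {}\<close> less by (intro sets.finite_INT) auto
    finally show ?thesis .
  qed

  have risk: "risk K Obs n N bh (mech (S v)) \<ge> ennreal ((b * \<theta>)\<^sup>2 / 2 * (real m - (\<Sum>k<m. measure (\<mu> v) (A k (v k)))))"
    if v: "v \<in> V" for v
  proof -
    interpret prob_space "\<mu> v" by (rule prob[OF v])
    have Av: "A k (v k) \<in> sets (\<mu> v)" if "k < m" for k
      using A[OF that vM[OF v that]] by (simp add: sets_\<mu>)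
    have "ennreal ((b * \<theta>)\<^sup>2 / 2 * (real m - (\<Sum>k<m. measure (\<mu> v) (A k (v k))))) =
        ennreal ((b * \<theta>)\<^sup>2 / 2 * (\<Sum>k<m. measure (\<mu> v) (space (\<mu> v) - A k (v k))))"
      using Av by (simp add: prob_compl sum_subtractf)
    also have "\<dots> = (\<Sum>k<m. ennreal ((b * \<theta>)\<^sup>2 / 2) * emeasure (\<mu> v) (space (\<mu> v) - A k (v k)))"
      by (simp add: sum_distrib_left emeasure_eq_measure ennreal_mult[symmetric] sum_ennreal)
    also have "\<dots> = (\<Sum>k<m. \<integral>\<^sup>+x. ennreal ((b * \<theta>)\<^sup>2 / 2) * indicator (space (\<mu> v) - A k (v k)) x \<partial>\<mu> v)"
      using Av by (intro sum.cong refl) (subst nn_integral_cmult_indicator, auto)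
    also have "\<dots> = (\<integral>\<^sup>+x. (\<Sum>k<m. ennreal ((b * \<theta>)\<^sup>2 / 2) * indicator (space (\<mu> v) - A k (v k)) x) \<partial>\<mu> v)"
      using Av by (subst nn_integral_sum) auto
    also have "\<dots> \<le> (\<integral>\<^sup>+x. ennreal ((norm (bh x - beta (mech (S v))))\<^sup>2) \<partial>\<mu> v)"
    proof (rule nn_integral_mono)
      fix x assume x: "x \<in> space (\<mu> v)"
      have "(\<Sum>k<m. ennreal ((b * \<theta>)\<^sup>2 / 2) * indicator (space (\<mu> v) - A k (v k)) x) =
          (\<Sum>k<m. ennreal ((b * \<theta>)\<^sup>2 / 2 * of_bool (x \<notin> strict_argmin bh (idx k) M (v k))))"
        using x by (intro sum.cong refl) (auto simp: A_def space_\<mu> indicator_def)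
      also have "\<dots> = ennreal ((b * \<theta>)\<^sup>2 / 2 * (\<Sum>k<m. of_bool (x \<notin> strict_argmin bh (idx k) M (v k))))"
        unfolding sum_distrib_left by (rule sum_ennreal) simp
      also have "\<dots> \<le> ennreal ((norm (bh x - beta (mech (S v))))\<^sup>2)"
        unfolding S_def using squared_error_ge[OF inj ne _ c, of v x bh] vM[OF v] by (intro ennreal_leI) auto
      finally show "(\<Sum>k<m. ennreal ((b * \<theta>)\<^sup>2 / 2) * indicator (space (\<mu> v) - A k (v k)) x) \<le>
          ennreal ((norm (bh x - beta (mech (S v))))\<^sup>2)" .
    qed
    finally show ?thesis unfolding risk_def \<mu>_def .
  qed

  have block: "(\<Sum>v\<in>V. measure (\<mu> v) (A k (v k))) \<le> real (card V) / 2" if k: "k < m" for k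
  proof -
    let ?W = "PiE ({..<m} - {k}) (\<lambda>_. {..<M})"
    have "card V = card ?W * M"
    proof -
      have "(\<Sum>v\<in>V. 1 :: nat) = (\<Sum>w\<in>?W. \<Sum>i<M. 1)"
        unfolding V_def using k by (intro sum_PiE_remove) auto
      then show ?thesis by simp
    qed
    have "(\<Sum>v\<in>V. measure (\<mu> v) (A k (v k))) = (\<Sum>w\<in>?W. \<Sum>i<M. measure (\<mu> (w(k := i))) (A k i))"
      unfolding V_def using k by (subst sum_PiE_remove[where b = k]) auto
    also have "\<dots> \<le> (\<Sum>w\<in>?W. real M / 2)"
    proof (rule sum_mono)
      fix w assume w: "w \<in> ?W"
      have "j \<notin> S' k w" using jS[OF upd(1)[OF w k, of 0]] upd(2)[OF w k, of 0] M by simp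
      then have "(\<Sum>i<M. measure (data_law K Obs n N (mech (insert (idx k i) (S' k w)))) (A k i)) \<le> real M / 2"
        using ne[OF k] upd(3)[OF w k] M A[OF k] disjoint_strict_argmin[of bh "idx k" M "space ?D"]
        by (intro sum_prob_data_law_le[OF _ _ count cost]) (auto simp: A_def)
      then show "(\<Sum>i<M. measure (\<mu> (w(k := i))) (A k i)) \<le> real M / 2"
        unfolding \<mu>_def using upd(2)[OF w k] by simp
    qed
    also have "\<dots> = real (card V) / 2" using \<open>card V = card ?W * M\<close> by simp
    finally show ?thesis .
  qed

  have "\<exists>v\<in>V. (\<Sum>k<m. measure (\<mu> v) (A k (v k))) \<le> real m / 2"
  proof (rule ccontr)
    assume "\<not> ?thesis"
    then have "(\<Sum>v\<in>V. real m / 2) < (\<Sum>v\<in>V. \<Sum>k<m. measure (\<mu> v) (A k (v k)))"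
      using \<open>finite V\<close> \<open>card V = M ^ m\<close> M
      by (intro sum_strict_mono) (auto simp: not_le)
    also have "\<dots> = (\<Sum>k<m. \<Sum>v\<in>V. measure (\<mu> v) (A k (v k)))" by (rule sum.swap)
    also have "\<dots> \<le> (\<Sum>k<m. real (card V) / 2)" by (intro sum_mono block) simp
    finally show False by simp
  qed
  then obtain v where v: "v \<in> V" "(\<Sum>k<m. measure (\<mu> v) (A k (v k))) \<le> real m / 2" by blast
  have "(b * \<theta>)\<^sup>2 * real m / 4 \<le> (b * \<theta>)\<^sup>2 / 2 * (real m - (\<Sum>k<m. measure (\<mu> v) (A k (v k))))"
    using mult_left_mono[of "real m / 2" "real m - (\<Sum>k<m. measure (\<mu> v) (A k (v k)))" "(b * \<theta>)\<^sup>2 / 2"] v(2) by simp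
  then have "ennreal ((b * \<theta>)\<^sup>2 * real m / 4) \<le> risk K Obs n N bh (mech (S v))"
    using risk[OF v(1)] by (meson ennreal_leI order_trans)
  then show ?thesis using v(1) unfolding V_def S_def by blast
qed

end

section \<open>Choice of the parameters\<close>

lemma exists_disjoint_blocks:
  fixes j :: "'p::finite"
  assumes "m * M \<le> CARD('p) - 1"
  shows "\<exists>idx :: nat \<Rightarrow> nat \<Rightarrow> 'p. inj_on (\<lambda>(k, i). idx k i) ({..<m} \<times> {..<M}) \<and>
    (\<forall>k<m. \<forall>i<M. idx k i \<noteq> j)"
proof -
  obtain f where f: "bij_betw f {0..<card (UNIV - {j})} (UNIV - {j})"
    using ex_bij_betw_nat_finite[of "UNIV - {j}"] by auto
  have less: "k * M + i < card (UNIV - {j})" if "k < m" "i < M" for k i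
  proof -
    have "k * M + i < Suc k * M" using that by simp
    also have "\<dots> \<le> m * M" using that by (intro mult_right_mono) auto
    finally show ?thesis using assms by (simp add: card_Diff_singleton)
  qed
  have "inj_on (\<lambda>(k, i). f (k * M + i)) ({..<m} \<times> {..<M})"
  proof (rule inj_onI, clarsimp)
    fix k i k' i' assume *: "k < m" "i < M" "k' < m" "i' < M" "f (k * M + i) = f (k' * M + i')"
    then have eq: "k * M + i = k' * M + i'"
      using f less by (auto simp: bij_betw_def dest: inj_onD)
    have "(k * M + i) div M = k" "(k' * M + i') div M = k'" using * by auto
    then have "k = k'" using eq by metis
    then show "k = k' \<and> i = i'" using eq by simp
  qed
  moreover have "f (k * M + i) \<noteq> j" if "k < m" "i < M" for k i
    using bij_betwE[OF f] less[OF that] by force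
  ultimately show ?thesis by (intro exI[of _ "\<lambda>k i. f (k * M + i)"]) auto
qed

text \<open>
  The minimum switches at \<open>x = 8/3\<close>, where the product attains its maximum.
\<close>

lemma min_one_div_square_mult_le:
  fixes x :: real
  assumes "x > 0"
  shows "min 1 (64 / (9 * x\<^sup>2)) * x \<le> 8 / 3"
proof (cases "x \<le> 8 / 3")
  case True
  have "min 1 (64 / (9 * x\<^sup>2)) * x \<le> 1 * x" using assms by (intro mult_right_mono) auto
  then show ?thesis using True by simp
next
  case False
  have "min 1 (64 / (9 * x\<^sup>2)) * x \<le> 64 / (9 * x\<^sup>2) * x" using assms by (intro mult_right_mono) auto
  also have "\<dots> = 64 / (9 * x)" using assms by (simp add: power2_eq_square)
  also have "\<dots> \<le> 8 / 3" using False assms by (simp add: field_simps)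
  finally show ?thesis .
qed

text \<open>
  Here \<open>t\<close> stands for \<open>\<theta>\<^sup>2\<close> and \<open>l\<close> for \<open>ln ((p - 1) / (2 m))\<close>. The factor \<open>h\<close> makes up for a signal \<open>B\<close> that is large
  compared with the noise, the factor \<open>g\<close> for covariates with a large variance; the
  three bounds are the perturbation bound on the covariance, the bound on the total cost \<open>chi2_cost T\<close> and the
  resulting value of the risk.
\<close>

lemma signal_size:
  fixes R B R\<^sub>X T l m :: real
  assumes pos: "R > 0" "B > 0" "R\<^sub>X > 0" "T > 0" "l > 0" "m \<ge> 1"
    and T: "T \<ge> 128 / 9 * m * l * min 1 (R\<^sup>2 / B\<^sup>2)"
  defines "g \<equiv> min 1 (64 / (9 * R\<^sub>X ^ 4))" and "h \<equiv> min 1 (R\<^sup>2 / B\<^sup>2)"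
  defines "t \<equiv> l / (2 * T) * (g * h / 16)"
  shows "t > 0" and "t * m \<le> 1 / 16"
    and "t * (1 + (4 / 5 * B)\<^sup>2 * (R\<^sub>X / 2)\<^sup>2 / R\<^sup>2) * T \<le> l / 2"
    and "(4 / 5 * B)\<^sup>2 * t * m / 4 = g * min (R\<^sup>2) (B\<^sup>2) * m * l / (200 * T)"
proof -
  have g: "0 < g" "g \<le> 1" and h: "0 < h" "h \<le> 1" using pos by (simp_all add: g_def h_def)
  show t: "t > 0" unfolding t_def using pos g h by simp
  have hB: "h * B\<^sup>2 = min (R\<^sup>2) (B\<^sup>2)"
    using pos by (simp add: h_def min_def field_simps)
  have "R\<^sub>X ^ 4 = (R\<^sub>X\<^sup>2)\<^sup>2" by simp
  then have gR: "g * R\<^sub>X\<^sup>2 \<le> 8 / 3"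
    unfolding g_def using min_one_div_square_mult_le[of "R\<^sub>X\<^sup>2"] pos by simp
  have "g * h \<le> h" using g h by simp
  have "m * l * h \<le> T * 9 / 128" using T by (simp add: h_def mult_ac)
  have "t * m = (m * l * (g * h)) / (32 * T)" by (simp add: t_def)
  also have "\<dots> \<le> (m * l * h) / (32 * T)"
    using \<open>g * h \<le> h\<close> pos by (intro divide_right_mono mult_left_mono) auto
  also have "\<dots> \<le> (T * 9 / 128) / (32 * T)"
    using \<open>m * l * h \<le> T * 9 / 128\<close> pos by (intro divide_right_mono) auto
  also have "\<dots> \<le> 1 / 16" using pos by simp
  finally show "t * m \<le> 1 / 16" .
  have "g * h * (1 + (4 / 5 * B)\<^sup>2 * (R\<^sub>X / 2)\<^sup>2 / R\<^sup>2) = g * h + 4 / 25 * (g * R\<^sub>X\<^sup>2) * (h * B\<^sup>2 / R\<^sup>2)"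
    by (simp add: power_mult_distrib power_divide algebra_simps)
  also have "\<dots> \<le> 1 + 4 / 25 * (8 / 3) * 1"
  proof (intro add_mono mult_mono mult_left_mono)
    show "g * h \<le> 1" using \<open>g * h \<le> h\<close> h by linarith
    show "h * B\<^sup>2 / R\<^sup>2 \<le> 1" unfolding hB using pos by simp
  qed (use gR g h pos in auto)
  also have "\<dots> \<le> 16" by simp
  finally have "g * h / 16 * (1 + (4 / 5 * B)\<^sup>2 * (R\<^sub>X / 2)\<^sup>2 / R\<^sup>2) \<le> 1" by simp
  then have "l / 2 * (g * h / 16 * (1 + (4 / 5 * B)\<^sup>2 * (R\<^sub>X / 2)\<^sup>2 / R\<^sup>2)) \<le> l / 2 * 1"
    using pos by (intro mult_left_mono) auto
  then show "t * (1 + (4 / 5 * B)\<^sup>2 * (R\<^sub>X / 2)\<^sup>2 / R\<^sup>2) * T \<le> l / 2"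
    using pos by (simp add: t_def mult_ac)
  have "(4 / 5 * B)\<^sup>2 * t * m / 4 = g * (h * B\<^sup>2) * m * l / (200 * T)"
    using pos by (simp add: t_def power2_eq_square field_simps)
  then show "(4 / 5 * B)\<^sup>2 * t * m / 4 = g * min (R\<^sup>2) (B\<^sup>2) * m * l / (200 * T)"
    by (simp only: hB)
qed

text \<open>
  The bound on \<open>p\<close> makes each block at least \<open>24 m\<close> long, so that the factor \<open>2\<close> in the logarithm more than covers
  the loss from rounding down \<open>(p - 1) / m\<close>.
\<close>

lemma block_length:
  fixes p m :: nat
  assumes p: "real p - 2 \<ge> 24 * (real m)\<^sup>2" and m: "m \<ge> 1"
  shows "(p - 1) div m \<ge> 16" and "1 < (real p - 1) / (2 * real m)"
    and "(real p - 1) / (2 * real m) \<le> real ((p - 1) div m)"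
    and "(real p - 1) / (2 * real m) \<le> real p - 2"
proof -
  have mm: "real m \<le> (real m)\<^sup>2" using m by (simp add: power2_eq_square)
  then have pm: "24 * real m + 1 \<le> real p - 1" using p by linarith
  then have p1: "real (p - 1) = real p - 1" "16 * m \<le> p - 1" using m by linarith+
  show M: "(p - 1) div m \<ge> 16" using p1(2) m by (simp add: less_eq_div_iff_mult_less_eq)
  show "1 < (real p - 1) / (2 * real m)" using pm m by (simp add: field_simps)
  have "(p - 1) mod m < m" using m by simp
  then have "p - 1 \<le> (p - 1) div m * m + m"
    using div_mult_mod_eq[of "p - 1" m] by linarith
  then have "p - 1 \<le> ((p - 1) div m + 1) * m" by simp
  then have "real (p - 1) \<le> real (((p - 1) div m + 1) * m)" by (rule of_nat_mono)
  also have "\<dots> \<le> (2 * real ((p - 1) div m)) * real m"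
    unfolding of_nat_mult using M by (intro mult_right_mono) auto
  finally show "(real p - 1) / (2 * real m) \<le> real ((p - 1) div m)"
    using m p1(1) by (simp add: field_simps)
  have "(real p - 1) / (2 * real m) \<le> (real p - 1) / 2"
    using m pm by (intro divide_left_mono) auto
  also have "\<dots> \<le> real p - 2"
  proof -
    have "real m \<ge> 1" using m by simp
    then show ?thesis using pm by (simp add: field_simps)
  qed
  finally show "(real p - 1) / (2 * real m) \<le> real p - 2" .
qed

theorem theorem7:
  fixes Obs :: "nat \<Rightarrow> 'p::finite set" and n :: "nat \<Rightarrow> nat" and K N s :: nat
    and R B R\<^sub>X \<Phi> \<rho> C :: real
  defines "p \<equiv> CARD('p)" and "n\<^sub>L \<equiv> \<Sum>k<K. n k"
  assumes "(\<Union>k<K. Obs k) = UNIV"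
    and "R > 0" and "B > 0" and "R\<^sub>X > 0" and "\<Phi> > 0" and "s \<le> p"
    and "\<Phi> < 3 * R\<^sub>X\<^sup>2 / 16"
    and "0 < \<rho>" and "\<rho> < 1" and "C > 1"
    and "\<exists>j::'p. \<forall>i. i \<noteq> j \<longrightarrow>
           (\<Sum>k<K. real (n k) * of_bool (i \<in> Obs k \<and> j \<in> Obs k)) \<le> C * \<rho>\<^sup>2 * real n\<^sub>L"
    and "real p - 2 \<ge> 24 * (real s - 1)\<^sup>2" and "s \<ge> 2"
    and "C * \<rho>\<^sup>2 * real n\<^sub>L + real N \<ge>
           128 * real s * ln (real p - 2) / 9 * max 1 (1 / R\<^sub>X ^ 4) * min (R\<^sup>2 / B\<^sup>2) 1"
  shows "(INF b\<in>Theta_HD K Obs n N R\<^sub>X R B s \<Phi>. SUP P\<in>P_HD R\<^sub>X R B s \<Phi>. risk K Obs n N b P) \<ge>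
    ennreal (1 / (2 ^ 17 * C) * min 1 (2 ^ 6 / (3\<^sup>2 * R\<^sub>X ^ 4)) *
      (min (R\<^sup>2) (B\<^sup>2) * real s * ln ((real p - 1) / (2 * (real s - 1))) /
        (\<rho>\<^sup>2 * real n\<^sub>L + real N)))"
proof (rule INF_greatest)
  fix bh assume bh: "bh \<in> Theta_HD K Obs n N R\<^sub>X R B s \<Phi>"
  obtain j :: 'p where count: "\<And>i. i \<noteq> j \<Longrightarrow>
      (\<Sum>k<K. real (n k) * of_bool (i \<in> Obs k \<and> j \<in> Obs k)) \<le> C * \<rho>\<^sup>2 * real n\<^sub>L"
    using assms by blast
  define m M where "m = s - 1" and "M = (p - 1) div m"
  define l T where "l = ln ((real p - 1) / (2 * real m))" and "T = C * \<rho>\<^sup>2 * real n\<^sub>L + real N"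
  define g where "g = min 1 (64 / (9 * R\<^sub>X ^ 4))"
  have m: "m \<ge> 1" "real m = real s - 1" "real m \<ge> real s / 2" using \<open>s \<ge> 2\<close> by (auto simp: m_def)
  have pm: "real p - 2 \<ge> 24 * (real m)\<^sup>2" using assms m by simp
  note len = block_length[OF pm m(1), folded M_def]
  have l: "l > 0" "l \<le> ln (real M)" "l \<le> ln (real p - 2)"
    unfolding l_def using len by (auto intro!: ln_gt_zero)
  have T: "T \<ge> 128 / 9 * m * l * min 1 (R\<^sup>2 / B\<^sup>2)"
  proof -
    have "128 / 9 * m * l * min 1 (R\<^sup>2 / B\<^sup>2) \<le> 128 / 9 * real s * ln (real p - 2) * min 1 (R\<^sup>2 / B\<^sup>2)"
      using l m by (intro mult_right_mono mult_mono) auto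
    also have "\<dots> \<le> 128 / 9 * real s * ln (real p - 2) * min 1 (R\<^sup>2 / B\<^sup>2) * max 1 (1 / R\<^sub>X ^ 4)"
      using l mult_left_mono[of 1 "max 1 (1 / R\<^sub>X ^ 4)" "128 / 9 * real s * ln (real p - 2) * min 1 (R\<^sup>2 / B\<^sup>2)"] by simp
    also have "\<dots> \<le> T" using assms by (simp add: T_def mult_ac min.commute)
    finally show ?thesis .
  qed
  have "T > 0"
    using T l m assms by (intro less_le_trans[OF _ T]) auto
  define t where "t = l / (2 * T) * (g * min 1 (R\<^sup>2 / B\<^sup>2) / 16)"
  have m1: "real m \<ge> 1" using m by simp
  note t = signal_size[OF \<open>R > 0\<close> \<open>B > 0\<close> \<open>R\<^sub>X > 0\<close> \<open>T > 0\<close> l(1) m1 T, folded g_def, folded t_def]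
  define \<theta> where "\<theta> = sqrt t"
  have \<theta>: "\<theta> > 0" "\<theta>\<^sup>2 = t" using t(1) by (simp_all add: \<theta>_def)
  \<comment> \<open>The factor \<open>4/5\<close> leaves room for the entries on \<open>S\<close>: the squared norm of the regression parameter
    is at most \<open>17/16 b\<^sup>2\<close>.\<close>
  interpret spiked_design j "R\<^sub>X / 2" \<theta> "4 / 5 * B" R
    using assms by unfold_locales auto
  have "m * M \<le> CARD('p) - 1" unfolding M_def p_def by simp
  then obtain idx :: "nat \<Rightarrow> nat \<Rightarrow> 'p" where inj: "inj_on (\<lambda>(k, i). idx k i) ({..<m} \<times> {..<M})"
    and ne: "\<And>k i. k < m \<Longrightarrow> i < M \<Longrightarrow> idx k i \<noteq> j"
    using exists_disjoint_blocks[of m M j] by blast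
  define S where "S = (\<lambda>v. (\<lambda>k. idx k (v k)) ` {..<m})"
  have in_class: "mech (S v) \<in> P_HD R\<^sub>X R B s \<Phi>" if v: "v \<in> PiE {..<m} (\<lambda>_. {..<M})" for v
  proof (rule mech_in_P_HD)
    show "j \<notin> S v" using ne v by (fastforce simp: S_def PiE_def)
    have "card (S v) \<le> m" unfolding S_def using card_image_le[of "{..<m}" "\<lambda>k. idx k (v k)"] by simp
    then show "card (S v) + 1 \<le> s" using \<open>s \<ge> 2\<close> by (simp add: m_def)
    have "\<theta>\<^sup>2 * real (card (S v)) \<le> \<theta>\<^sup>2 * real m" using \<open>card (S v) \<le> m\<close> by (intro mult_left_mono) auto
    then show "\<theta>\<^sup>2 * real (card (S v)) \<le> 1/16" using t(2) by (simp add: \<theta>(2))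
    show "17/16 * (4 / 5 * B)\<^sup>2 \<le> B\<^sup>2" by (simp add: power_mult_distrib power_divide)
  qed (use assms in auto)
  have meas: "(\<lambda>x. norm (bh x - beta (mech (S v)))) \<in> borel_measurable (data_space K Obs n N)"
    if "v \<in> PiE {..<m} (\<lambda>_. {..<M})" for v
    using bh in_class[OF that] unfolding Theta_HD_def by blast
  have "chi2_cost = t * (1 + (4 / 5 * B)\<^sup>2 * (R\<^sub>X / 2)\<^sup>2 / R\<^sup>2)"
    unfolding chi2_cost_def info_def power_mult_distrib \<theta>(2) using \<open>R\<^sub>X > 0\<close> by (simp add: field_simps)
  then have cost: "chi2_cost * T \<le> ln (real M) / 2" using t(3) l(2) by simp
  have "\<exists>v\<in>PiE {..<m} (\<lambda>_. {..<M}).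
      risk K Obs n N bh (mech (S v)) \<ge> ennreal ((4 / 5 * B * \<theta>)\<^sup>2 * real m / 4)"
    unfolding S_def
  proof (rule exists_mech_with_large_risk[OF inj ne _ len(1) _ cost meas[unfolded S_def]])
    show "0 < 4 / 5 * B * \<theta>" using \<open>B > 0\<close> \<theta>(1) by simp
    show "(\<Sum>k<K. real (n k) * of_bool (i \<in> Obs k \<and> j \<in> Obs k)) + real N \<le> T" if "i \<noteq> j" for i
      using count[OF that] unfolding T_def by linarith
  qed
  then obtain v where v: "v \<in> PiE {..<m} (\<lambda>_. {..<M})"
    and risk: "ennreal ((4 / 5 * B * \<theta>)\<^sup>2 * real m / 4) \<le> risk K Obs n N bh (mech (S v))"
    by blast
  have "1 / (2 ^ 17 * C) * min 1 (2 ^ 6 / (3\<^sup>2 * R\<^sub>X ^ 4)) *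
      (min (R\<^sup>2) (B\<^sup>2) * real s * ln ((real p - 1) / (2 * (real s - 1))) / (\<rho>\<^sup>2 * real n\<^sub>L + real N))
    \<le> g * min (R\<^sup>2) (B\<^sup>2) * m * l / (200 * T)"
  proof -
    define q where "q = \<rho>\<^sup>2 * real n\<^sub>L + real N"
    define w where "w = g * min (R\<^sup>2) (B\<^sup>2) * l"
    have "w \<ge> 0" using assms l by (simp add: w_def g_def)
    have "T \<le> C * q"
      using mult_right_mono[of 1 C "real N"] \<open>C > 1\<close> by (simp add: T_def q_def algebra_simps)
    then have "q > 0" using \<open>T > 0\<close> \<open>C > 1\<close> by (smt (verit) zero_less_mult_pos)
    have "w * real s / (2 ^ 17 * (C * q)) \<le> w * (real m * 2) / (400 * T)"
      using \<open>w \<ge> 0\<close> \<open>T > 0\<close> \<open>T \<le> C * q\<close> m by (intro frac_le mult_left_mono mult_mono) auto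
    then show ?thesis
      unfolding q_def[symmetric] g_def[symmetric] m(2)[symmetric] l_def[symmetric]
      by (simp add: w_def g_def mult_ac)
  qed
  also have "\<dots> = (4 / 5 * B * \<theta>)\<^sup>2 * real m / 4"
    unfolding power_mult_distrib[of "4 / 5 * B" \<theta>] \<theta>(2) t(4) ..
  finally have "ennreal (1 / (2 ^ 17 * C) * min 1 (2 ^ 6 / (3\<^sup>2 * R\<^sub>X ^ 4)) *
      (min (R\<^sup>2) (B\<^sup>2) * real s * ln ((real p - 1) / (2 * (real s - 1))) / (\<rho>\<^sup>2 * real n\<^sub>L + real N)))
    \<le> risk K Obs n N bh (mech (S v))"
    using risk by (meson ennreal_leI order_trans)
  also have "\<dots> \<le> (SUP P\<in>P_HD R\<^sub>X R B s \<Phi>. risk K Obs n N bh P)"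
    by (rule SUP_upper) (rule in_class[OF v])
  finally show "ennreal (1 / (2 ^ 17 * C) * min 1 (2 ^ 6 / (3\<^sup>2 * R\<^sub>X ^ 4)) *
      (min (R\<^sup>2) (B\<^sup>2) * real s * ln ((real p - 1) / (2 * (real s - 1))) / (\<rho>\<^sup>2 * real n\<^sub>L + real N)))
    \<le> (SUP P\<in>P_HD R\<^sub>X R B s \<Phi>. risk K Obs n N bh P)" .
qed

end
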